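(* Let $\{X_n\}_{n\in\mathbb{Z}}$ be a zero-mean, regular, real-valued, discrete-time wide sense stationary process with finite second moment, unit-variance innovation process, covariance sequence $\{R_k\}_{k\in\mathbb{Z}}$ and spectral density $S_X$. Suppose that $S_X(\lambda)>0$ for all $\lambda\in(-\tfrac12,\tfrac12]$ and that $\sum_{k\in\mathbb{Z}}|R_k|<\infty$. For $p\in\mathbb{N}$ let $\overline{X}_{n,p}=\overline{\mathbb{E}}[X_n|H_{n-1}^p]$ be the best linear (minimum mean squared error) estimate of $X_n$ from $X_{n-1},\ldots,X_{n-p}$, and let $\overline{X}_n=\overline{\mathbb{E}}[X_n|H_{n-1}]$ be the best linear estimate of $X_n$ from its entire past. Let $S_{\overline{X}_p}$ and $S_{\overline{X}}$ be the spectral densities of the processes $\{\overline{X}_{n,p}\}_{n\in\mathbb{Z}}$ and $\{\overline{X}_n\}_{n\in\mathbb{Z}}$. Then the spectral density of $\overline{X}_{n,p}$ converges to that of $\overline{X}_n$ at the origin: $$\lim_{p\to\infty}S_{\overline{X}_p}(0)=S_{\overline{X}}(0).$$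
   Context: All random variables are real-valued, have zero mean and lie in the Hilbert space $L_2(\mathbb{P})$ of square-integrable random variables on a probability space, with inner product $\mathbb{E}[XY]$. For a wide sense stationary (WSS) process with covariance sequence $R_k=\mathbb{E}[X_{n+k}X_n]$, the spectral density is $S(\lambda)=\sum_{k\in\mathbb{Z}}R_ke^{-2\pi i\lambda k}$, $\lambda\in(-\tfrac12,\tfrac12]$. $H_n$ denotes the closed linear span of $\{X_n,X_{n-1},X_{n-2},\ldots\}$ in $L_2(\mathbb{P})$, and $H_n^p$ denotes the linear span of $\{X_n,X_{n-1},\ldots,X_{n-p+1}\}$. $\overline{\mathbb{E}}[Y|H]$ denotes the orthogonal projection of $Y$ onto the closed subspace $H$. The process is regular (purely nondeterministic) if $\bigcap_n H_n=\{0\}$. The innovation process is $\nu_n=X_n-\overline{\mathbb{E}}[X_n|H_{n-1}]$, with $\mathbb{E}[\nu_n\nu_k]=\sigma^2\delta_{n-k}$, normalized so that $\sigma^2=1$. *)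

theory Defs
  imports "HOL-Probability.Probability"
begin

definition square_integrable :: "'a measure \<Rightarrow> ('a \<Rightarrow> real) set" where
  "square_integrable M = {Y \<in> borel_measurable M. integrable M (\<lambda>\<omega>. (Y \<omega>)\<^sup>2)}"

text \<open>
  Elements of \<open>L\<^sub>2\<close> are represented by square-integrable functions, not by equivalence classes modulo
  almost sure equality.
\<close>

definition lin_span :: "(int \<Rightarrow> 'a \<Rightarrow> real) \<Rightarrow> int set \<Rightarrow> ('a \<Rightarrow> real) set" where
  "lin_span X I = {(\<lambda>\<omega>. \<Sum>k\<in>F. c k * X k \<omega>) | F c. finite F \<and> F \<subseteq> I}"

definition closed_lin_span ::
    "'a measure \<Rightarrow> (int \<Rightarrow> 'a \<Rightarrow> real) \<Rightarrow> int set \<Rightarrow> ('a \<Rightarrow> real) set" where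
  "closed_lin_span M X I =
     {Y \<in> square_integrable M. \<forall>e>0. \<exists>Z \<in> lin_span X I. (\<integral>\<omega>. (Y \<omega> - Z \<omega>)\<^sup>2 \<partial>M) < e}"

definition past :: "'a measure \<Rightarrow> (int \<Rightarrow> 'a \<Rightarrow> real) \<Rightarrow> int \<Rightarrow> ('a \<Rightarrow> real) set" where
  "past M X n = closed_lin_span M X {..n}"

definition finite_past :: "(int \<Rightarrow> 'a \<Rightarrow> real) \<Rightarrow> nat \<Rightarrow> int \<Rightarrow> ('a \<Rightarrow> real) set" where
  "finite_past X p n = lin_span X {n - int p + 1..n}"

text \<open>
  For the subspaces used here the orthogonal projection exists and is unique up to almost sure
  equality; the choice operator picks one representative.
\<close>

definition orth_proj ::
    "'a measure \<Rightarrow> ('a \<Rightarrow> real) set \<Rightarrow> ('a \<Rightarrow> real) \<Rightarrow> 'a \<Rightarrow> real" where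
  "orth_proj M H Y = (SOME Z. Z \<in> H \<and> (\<forall>W\<in>H. (\<integral>\<omega>. (Y \<omega> - Z \<omega>) * W \<omega> \<partial>M) = 0))"

definition zero_mean_wss :: "'a measure \<Rightarrow> (int \<Rightarrow> 'a \<Rightarrow> real) \<Rightarrow> bool" where
  "zero_mean_wss M X \<longleftrightarrow>
     (\<forall>n. X n \<in> square_integrable M) \<and>
     (\<forall>n. (\<integral>\<omega>. X n \<omega> \<partial>M) = 0) \<and>
     (\<forall>n m k. (\<integral>\<omega>. X (n + k) \<omega> * X n \<omega> \<partial>M) = (\<integral>\<omega>. X (m + k) \<omega> * X m \<omega> \<partial>M))"

text \<open>By stationarity the covariance sequence may be read off at time \<open>0\<close>.\<close>

definition cov_seq :: "'a measure \<Rightarrow> (int \<Rightarrow> 'a \<Rightarrow> real) \<Rightarrow> int \<Rightarrow> real" where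
  "cov_seq M X k = (\<integral>\<omega>. X k \<omega> * X 0 \<omega> \<partial>M)"

text \<open>
  The real part only fixes the type: the series itself is real for a wide sense stationary process,
  see \<open>of_real_spectral_density\<close> below.
\<close>

definition spectral_density :: "'a measure \<Rightarrow> (int \<Rightarrow> 'a \<Rightarrow> real) \<Rightarrow> real \<Rightarrow> real" where
  "spectral_density M X l =
     Re (\<Sum>\<^sub>\<infinity>k. of_real (cov_seq M X k) * exp (- 2 * of_real pi * \<i> * of_real l * of_int k))"

text \<open>
  An intersection \<open>{0}\<close> in \<open>L\<^sub>2\<close> means that exactly the almost surely vanishing functions are in it.
\<close>

definition regular_process :: "'a measure \<Rightarrow> (int \<Rightarrow> 'a \<Rightarrow> real) \<Rightarrow> bool" where
  "regular_process M X \<longleftrightarrow>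
     (\<Inter>n. past M X n) = {Y \<in> borel_measurable M. AE \<omega> in M. Y \<omega> = 0}"

definition predictor :: "'a measure \<Rightarrow> (int \<Rightarrow> 'a \<Rightarrow> real) \<Rightarrow> int \<Rightarrow> 'a \<Rightarrow> real" where
  "predictor M X n = orth_proj M (past M X (n - 1)) (X n)"

definition finite_predictor ::
    "'a measure \<Rightarrow> (int \<Rightarrow> 'a \<Rightarrow> real) \<Rightarrow> nat \<Rightarrow> int \<Rightarrow> 'a \<Rightarrow> real" where
  "finite_predictor M X p n = orth_proj M (finite_past X p (n - 1)) (X n)"

definition innovation :: "'a measure \<Rightarrow> (int \<Rightarrow> 'a \<Rightarrow> real) \<Rightarrow> int \<Rightarrow> 'a \<Rightarrow> real" where
  "innovation M X n = (\<lambda>\<omega>. X n \<omega> - predictor M X n \<omega>)"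

lemma cov_seq_uminus:
  assumes "zero_mean_wss M X"
  shows "cov_seq M X (- k) = cov_seq M X k"
proof -
  have "(\<integral>\<omega>. X (0 + - k) \<omega> * X 0 \<omega> \<partial>M) = (\<integral>\<omega>. X (k + - k) \<omega> * X k \<omega> \<partial>M)"
    using assms unfolding zero_mean_wss_def by blast
  then show ?thesis
    by (simp add: cov_seq_def mult.commute)
qed

lemma of_real_spectral_density:
  assumes "zero_mean_wss M X"
  shows "complex_of_real (spectral_density M X l) =
    (\<Sum>\<^sub>\<infinity>k. of_real (cov_seq M X k) * exp (- 2 * of_real pi * \<i> * of_real l * of_int k))"
proof -
  let ?f = "\<lambda>k. complex_of_real (cov_seq M X k) *
    exp (- 2 * of_real pi * \<i> * of_real l * of_int k)"
  have "cnj (infsum ?f UNIV) = (\<Sum>\<^sub>\<infinity>k. cnj (?f k))"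
    by (rule infsum_cnj [symmetric])
  also have "\<dots> = (\<Sum>\<^sub>\<infinity>k. ?f (- k))"
    by (simp add: cov_seq_uminus[OF assms] exp_cnj)
  also have "\<dots> = infsum ?f UNIV"
    by (rule infsum_reindex_bij_betw) (simp add: bij_uminus)
  finally have "infsum ?f UNIV \<in> \<real>"
    by (simp add: Reals_cnj_iff)
  then show ?thesis
    unfolding spectral_density_def by (simp add: of_real_Re)
qed

end

theory Submission
  imports Defs
begin

text \<open>
  Both predictors are linear filters of the process, and at frequency zero a filter with summable
  coefficients \<open>a\<close> multiplies the spectral density by \<open>(\<Sum>j. a j)\<^sup>2\<close>
  (\<open>linear_filter_spectral_density_0\<close>). So it suffices to show that the predictor coefficients are
  summable and that their sums converge as the order \<open>p\<close> grows.
  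
  The coefficients come from Toeplitz systems. If \<open>u\<close> solves \<open>\<Sum>j. R (i - j) * u j = [i = 0]\<close>, the sum
  and the index \<open>i\<close> both ranging over \<open>0..p\<close>, then \<open>\<Sum>j. u j * X (n - j)\<close> is orthogonal to
  \<open>X (n - 1), \<dots>, X (n - p)\<close>, hence a multiple of the prediction error, and the predictor has the
  coefficients \<open>- u j / u 0\<close>. The infinite past leads in the same way to a summable solution \<open>v\<close> of the
  system on all of \<open>0, 1, 2, \<dots>\<close>, a discrete Wiener-Hopf equation.
  
  What has to be proved is thus the inequality of Baxter: the finite solutions converge to \<open>v\<close> in the
  summable norm. It follows from one estimate, \<open>l1_stability\<close>: on every finite set of indices,
  \<open>\<Sum>i. \<bar>x i\<bar>\<close> is at most a fixed multiple of \<open>\<Sum>i. \<bar>(T x) i\<bar>\<close>, where \<open>T\<close> is the Toeplitz matrix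
  on that set. In the Euclidean norm such an estimate is immediate, because the symbol, the
  spectral density, has a positive minimum (\<open>positive_toeplitzI\<close>, \<open>L2_lower_bound\<close>). The passage to
  the summable norm is a quantitative form of Wiener's lemma on inverses of absolutely convergent
  Fourier series, and it is obtained by localization: multiply \<open>x\<close> by a slowly varying weight
  centred at \<open>k\<close>, use the Euclidean bound on the product, and add up over all \<open>k\<close>. The
  commutator of \<open>T\<close> with the weight is small, since \<open>R\<close> is summable.
  
  Given the stability, the solutions are bounded in the summable norm, converge entrywise by an energy
  argument (\<open>inverse_column_diff\<close>), and their limit \<open>v\<close> is summable and solves the Wiener-Hopf
  equation. Applying the stability once more, to the difference of the finite solution and
  the truncation of \<open>v\<close>, bounds it by the tail of \<open>v\<close>.
\<close>


section \<open>Toeplitz forms with a positive symbol\<close>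

lemma has_integral_cos_period:
  fixes m :: int
  shows "((\<lambda>l. cos (2 * pi * m * l)) has_integral of_bool (m = 0)) {0..1}"
proof (cases "m = 0")
  case True
  then show ?thesis
    using has_integral_const_real[of "1::real" 0 1] by simp
next
  case False
  have "((\<lambda>l. cos (2 * pi * m * l)) has_integral
      (sin (2 * pi * m * 1) / (2 * pi * m) - sin (2 * pi * m * 0) / (2 * pi * m))) {0..1}"
    by (rule fundamental_theorem_of_calculus)
       (use False in \<open>auto intro!: derivative_eq_intros
          simp: has_real_derivative_iff_has_vector_derivative[symmetric]\<close>)
  moreover have "sin (2 * pi * m) = 0"
    by (rule sin_int_2pin)
  ultimately show ?thesis
    using False by simp
qed

lemma has_integral_cos_product_period:
  fixes k m :: int
  shows "((\<lambda>l. cos (2 * pi * k * l) * cos (2 * pi * m * l)) has_integral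
    (of_bool (k = m) + of_bool (k = - m)) / 2) {0..1}"
proof -
  have "((\<lambda>l. (cos (2 * pi * (k - m) * l) + cos (2 * pi * (k + m) * l)) / 2) has_integral
    (of_bool (k - m = 0) + of_bool (k + m = 0)) / 2) {0..1}"
    using has_integral_cos_period[of "k - m"] has_integral_cos_period[of "k + m"]
    by (intro has_integral_divide has_integral_add) (auto simp: algebra_simps)
  moreover have "(cos (2 * pi * (k - m) * l) + cos (2 * pi * (k + m) * l)) / 2 =
      cos (2 * pi * k * l) * cos (2 * pi * m * l)" for l
    by (simp add: cos_times_cos algebra_simps)
  moreover have "k - m = 0 \<longleftrightarrow> k = m" "k + m = 0 \<longleftrightarrow> k = - m"
    by auto
  ultimately show ?thesis
    by simp
qed

lemma abs_summable_tail_small: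
  fixes R :: "int \<Rightarrow> real"
  assumes "(\<lambda>k. \<bar>R k\<bar>) summable_on UNIV" "0 < e"
  obtains D where "finite D" "\<And>E. finite E \<Longrightarrow> (\<Sum>k\<in>E - D. \<bar>R k\<bar>) \<le> e"
proof -
  obtain D where D: "finite D" "dist (\<Sum>k\<in>D. \<bar>R k\<bar>) (\<Sum>\<^sub>\<infinity>k. \<bar>R k\<bar>) \<le> e"
    using infsum_finite_approximation[OF assms] by auto
  have "(\<Sum>k\<in>E - D. \<bar>R k\<bar>) \<le> e" if "finite E" for E
  proof -
    have "(\<Sum>k\<in>E - D. \<bar>R k\<bar>) + (\<Sum>k\<in>D. \<bar>R k\<bar>) = (\<Sum>k\<in>(E - D) \<union> D. \<bar>R k\<bar>)"
      using D(1) that by (intro sum.union_disjoint[symmetric]) auto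
    also have "\<dots> \<le> (\<Sum>\<^sub>\<infinity>k. \<bar>R k\<bar>)"
      using D(1) that assms(1) by (intro finite_sum_le_infsum) auto
    finally show ?thesis
      using D(2) by (auto simp: dist_real_def)
  qed
  then show ?thesis
    using that D(1) by blast
qed

text \<open>
  All Toeplitz sections are bounded below by \<open>c\<close>, on arbitrary finite sets of integers and not only on
  intervals; this makes the estimates below independent of the section.
\<close>

locale positive_toeplitz =
  fixes R :: "int \<Rightarrow> real" and c :: real
  assumes R_summable: "(\<lambda>k. \<bar>R k\<bar>) summable_on UNIV"
    and R_even: "R (- k) = R k"
    and c_pos: "0 < c"
    and coercive: "finite F \<Longrightarrow>
      c * (\<Sum>i\<in>F. (x i)\<^sup>2) \<le> (\<Sum>i\<in>F. x i * (\<Sum>j\<in>F. R (i - j) * x j))"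

text \<open>
  By Parseval the quadratic form of a section is the integral of the symbol against
  \<open>\<bar>\<Sum>i. x i * exp (2 * \<pi> * \<i> * i * l)\<bar>\<^sup>2\<close>, so it inherits half the minimum of the symbol as
  a lower bound. Only finitely many covariances enter a given form. Replacing the symbol by a partial
  sum that contains all of them and is uniformly close to it keeps every integral one
  of a trigonometric polynomial.
\<close>

lemma positive_toeplitzI:
  fixes R :: "int \<Rightarrow> real"
  assumes summable: "(\<lambda>k. \<bar>R k\<bar>) summable_on UNIV"
    and even: "\<And>k. R (- k) = R k"
    and pos: "\<And>l. l \<in> {- (1/2)<..1/2} \<Longrightarrow> (\<Sum>\<^sub>\<infinity>k. R k * cos (2 * pi * of_int k * l)) > 0"
  obtains c where "positive_toeplitz R c"
proof -
  define S where "S l = (\<Sum>\<^sub>\<infinity>k. R k * cos (2 * pi * of_int k * l))" for l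
  have unif: "uniform_limit UNIV (\<lambda>D l. \<Sum>k\<in>D. R k * cos (2 * pi * of_int k * l)) S (finite_subsets_at_top UNIV)"
    unfolding S_def
    by (rule Weierstrass_m_test_general[where M = "\<lambda>k. \<bar>R k\<bar>"])
       (use summable in \<open>auto simp: abs_mult intro!: mult_left_le\<close>)
  have cont: "continuous_on UNIV S"
    by (rule uniform_limit_theorem[OF _ unif])
       (auto intro!: always_eventually continuous_intros)
  have period: "S (l + 1) = S l" for l
  proof -
    have "cos (2 * pi * of_int k * (l + 1)) = cos (2 * pi * of_int k * l)" for k :: int
    proof -
      have "2 * pi * of_int k * (l + 1) = 2 * pi * of_int k * l + 2 * pi * of_int k"
        by (simp add: algebra_simps)
      then show ?thesis
        by (simp add: cos_add sin_int_2pin cos_int_2pin)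
    qed
    then show ?thesis
      by (simp add: S_def)
  qed
  have S_pos: "S l > 0" for l
  proof -
    define n where "n = \<lceil>l - 1/2\<rceil>"
    have shift: "S (l' + of_nat k) = S l'" for l' and k :: nat
      by (induction k) (auto simp: period add.assoc[symmetric] add.commute[of 1])
    have "l - of_int n \<in> {- (1/2)<..1/2}"
      unfolding n_def by (auto; linarith)
    then have "S (l - of_int n) > 0"
      using pos unfolding S_def by blast
    moreover have "S (l - of_int n) = S l"
    proof (cases "n \<ge> 0")
      case True
      then show ?thesis
        using shift[of "l - of_int n" "nat n"] by simp
    next
      case False
      then show ?thesis
        using shift[of l "nat (- n)"] by simp
    qed
    ultimately show ?thesis
      by simp
  qed
  have "\<exists>l0\<in>{0..1}. \<forall>l\<in>{0..1}. S l0 \<le> S l"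
    by (rule continuous_attains_inf) (auto intro: continuous_on_subset[OF cont])
  then obtain l0 where l0: "\<And>l. l \<in> {0..1} \<Longrightarrow> S l0 \<le> S l"
    by blast
  define c where "c = S l0 / 2"
  have c_pos: "0 < c"
    using S_pos[of l0] by (simp add: c_def)
  have coercive: "c * (\<Sum>i\<in>F. (x i)\<^sup>2) \<le> (\<Sum>i\<in>F. x i * (\<Sum>j\<in>F. R (i - j) * x j))"
    if F: "finite F" for F and x :: "int \<Rightarrow> real"
  proof -
    have "\<forall>\<^sub>F D in finite_subsets_at_top UNIV. \<forall>l\<in>UNIV.
        dist (\<Sum>k\<in>D. R k * cos (2 * pi * of_int k * l)) (S l) < c"
      using unif c_pos by (rule uniform_limitD)
    then obtain D0 where D0: "finite D0"
      "\<And>D l. finite D \<Longrightarrow> D0 \<subseteq> D \<Longrightarrow> dist (\<Sum>k\<in>D. R k * cos (2 * pi * of_int k * l)) (S l) < c"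
      unfolding eventually_finite_subsets_at_top by auto
    define D where "D = D0 \<union> (\<lambda>(i, j). i - j) ` (F \<times> F)"
    have D: "finite D" "D0 \<subseteq> D" "\<And>i j. i \<in> F \<Longrightarrow> j \<in> F \<Longrightarrow> i - j \<in> D"
      using D0(1) F by (auto simp: D_def)
    define SD where "SD l = (\<Sum>k\<in>D. R k * cos (2 * pi * of_int k * l))" for l
    \<comment> \<open>The real form of \<open>\<bar>\<Sum>i\<in>F. x i * exp (2 * \<pi> * \<i> * i * l)\<bar>\<^sup>2\<close>.\<close>
    define P where "P l = (\<Sum>i\<in>F. \<Sum>j\<in>F. x i * x j * cos (2 * pi * of_int (i - j) * l))" for l
    have SD: "SD l \<ge> c" if "l \<in> {0..1}" for l
      using D0(2)[OF D(1,2), of l] l0[OF that] unfolding SD_def c_def dist_real_def by linarith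
    have P: "P l \<ge> 0" for l
    proof -
      have "P l = (\<Sum>i\<in>F. x i * cos (2 * pi * of_int i * l))\<^sup>2 + (\<Sum>i\<in>F. x i * sin (2 * pi * of_int i * l))\<^sup>2"
        unfolding P_def power2_eq_square sum_product sum.distrib[symmetric]
        by (intro sum.cong refl) (simp add: cos_diff algebra_simps)
      then show ?thesis
        by simp
    qed
    have int_P: "(P has_integral (\<Sum>i\<in>F. \<Sum>j\<in>F. x i * x j * of_bool (i - j = 0))) {0..1}"
      unfolding P_def
      by (intro has_integral_sum F has_integral_mult_right has_integral_cos_period)
    have "((\<lambda>l. \<Sum>k\<in>D. \<Sum>i\<in>F. \<Sum>j\<in>F. (R k * (x i * x j)) *
        (cos (2 * pi * of_int k * l) * cos (2 * pi * of_int (i - j) * l))) has_integral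
      (\<Sum>k\<in>D. \<Sum>i\<in>F. \<Sum>j\<in>F. (R k * (x i * x j)) *
        ((of_bool (k = i - j) + of_bool (k = - (i - j))) / 2))) {0..1}"
      by (intro has_integral_sum F D has_integral_mult_right has_integral_cos_product_period)
    moreover have "(\<Sum>k\<in>D. \<Sum>i\<in>F. \<Sum>j\<in>F. (R k * (x i * x j)) *
        (cos (2 * pi * of_int k * l) * cos (2 * pi * of_int (i - j) * l))) = SD l * P l" for l
      unfolding SD_def P_def sum_distrib_right[of _ D]
      unfolding sum_distrib_left
      by (intro sum.cong refl) (simp add: algebra_simps)
    moreover have "(\<Sum>k\<in>D. \<Sum>i\<in>F. \<Sum>j\<in>F. (R k * (x i * x j)) *
        ((of_bool (k = i - j) + of_bool (k = - (i - j))) / 2)) =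
        (\<Sum>i\<in>F. x i * (\<Sum>j\<in>F. R (i - j) * x j))" (is "?L = _")
    proof -
      have "?L = (\<Sum>i\<in>F. \<Sum>j\<in>F. \<Sum>k\<in>D. (R k * (x i * x j)) *
        ((of_bool (k = i - j) + of_bool (k = - (i - j))) / 2))"
        by (simp only: sum.swap[of _ _ D])
      also have "\<dots> = (\<Sum>i\<in>F. \<Sum>j\<in>F. R (i - j) * x i * x j)"
      proof (intro sum.cong refl)
        fix i j assume ij: "i \<in> F" "j \<in> F"
        have "(\<Sum>k\<in>D. (R k * (x i * x j)) * ((of_bool (k = i - j) + of_bool (k = - (i - j))) / 2)) =
          (\<Sum>k\<in>D. if k = i - j then R k * (x i * x j) / 2 else 0) +
          (\<Sum>k\<in>D. if k = j - i then R k * (x i * x j) / 2 else 0)"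
          unfolding sum.distrib[symmetric]
          by (intro sum.cong refl) (auto simp: field_simps)
        also have "\<dots> = R (i - j) * x i * x j"
          using D ij even[of "i - j"] by (simp add: sum.delta)
        finally show "(\<Sum>k\<in>D. (R k * (x i * x j)) * ((of_bool (k = i - j) + of_bool (k = - (i - j))) / 2)) =
          R (i - j) * x i * x j" .
      qed
      also have "\<dots> = (\<Sum>i\<in>F. x i * (\<Sum>j\<in>F. R (i - j) * x j))"
        by (simp add: sum_distrib_left algebra_simps)
      finally show ?thesis .
    qed
    ultimately have int_SP: "((\<lambda>l. SD l * P l) has_integral (\<Sum>i\<in>F. x i * (\<Sum>j\<in>F. R (i - j) * x j))) {0..1}"
      by simp
    have "c * (\<Sum>i\<in>F. \<Sum>j\<in>F. x i * x j * of_bool (i - j = 0)) \<le> (\<Sum>i\<in>F. x i * (\<Sum>j\<in>F. R (i - j) * x j))"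
      using SD P by (intro has_integral_le[OF has_integral_mult_right[OF int_P] int_SP] mult_right_mono)
    moreover have "(\<Sum>j\<in>F. x i * x j * of_bool (i - j = 0)) = (x i)\<^sup>2" if "i \<in> F" for i
    proof -
      have "(\<Sum>j\<in>F. x i * x j * of_bool (i - j = 0)) = (\<Sum>j\<in>F. if j = i then x i * x j else 0)"
        by (intro sum.cong) auto
      then show ?thesis
        using F that by (simp add: power2_eq_square)
    qed
    ultimately show ?thesis
      by simp
  qed
  have "positive_toeplitz R c"
    by unfold_locales (use summable even c_pos coercive in auto)
  then show ?thesis
    using that by blast
qed

section \<open>Stability in the summable norm\<close>

lemma summable_on_two_sided_geometric:
  fixes r :: real
  assumes "0 < r" "r < 1"
  shows "(\<lambda>k::int. r ^ nat \<bar>k\<bar>) summable_on UNIV"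
proof -
  have geo: "(\<lambda>n::nat. r ^ n) summable_on UNIV"
    using assms by (intro norm_summable_imp_summable_on) (auto simp: summable_geometric)
  have "(\<lambda>k::int. r ^ nat \<bar>k\<bar>) summable_on range int"
    by (subst summable_on_reindex) (use geo in \<open>auto simp: o_def\<close>)
  moreover have "(\<lambda>k::int. r ^ nat \<bar>k\<bar>) summable_on range (\<lambda>n. - int n)"
    by (subst summable_on_reindex) (use geo in \<open>auto simp: o_def inj_def\<close>)
  moreover have "range int \<union> range (\<lambda>n. - int n) = UNIV"
  proof -
    have "k \<in> range int \<union> range (\<lambda>n. - int n)" for k
      by (cases k rule: int_cases2) auto
    then show ?thesis
      by auto
  qed
  ultimately show ?thesis
    by (metis summable_on_union)
qed

text \<open>
  The two-sided geometric weight varies slowly relative to its own size: shifting it by at most \<open>K\<close>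
  changes it by a small multiple of itself once \<open>r\<close> is close to \<open>1\<close>.
\<close>

lemma geometric_weight_diff:
  fixes r :: real and j m :: int
  assumes r: "0 < r" "r < 1" and m: "\<bar>m\<bar> \<le> int K"
  shows "\<bar>r ^ nat \<bar>j + m\<bar> - r ^ nat \<bar>j\<bar>\<bar> \<le> (1 / r ^ K - 1) * r ^ nat \<bar>j\<bar>"
proof -
  define a b where "a = nat \<bar>j + m\<bar>" and "b = nat \<bar>j\<bar>"
  have ab: "a \<le> b + K" "b \<le> a + K"
    using m by (auto simp: a_def b_def)
  have "r ^ a * r ^ K \<le> r ^ b"
    unfolding power_add[symmetric] using r ab by (intro power_decreasing) auto
  then have upper: "r ^ a \<le> r ^ b / r ^ K"
    using r by (simp add: field_simps)
  have "r ^ b * r ^ K \<le> r ^ a"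
    unfolding power_add[symmetric] using r ab by (intro power_decreasing) auto
  moreover have "2 \<le> r ^ K + 1 / r ^ K"
  proof -
    have "0 \<le> (r ^ K - 1)\<^sup>2 / r ^ K"
      using r by simp
    also have "\<dots> = r ^ K + 1 / r ^ K - 2"
      using r by (simp add: field_simps power2_eq_square)
    finally show ?thesis by simp
  qed
  then have "r ^ b * 2 \<le> r ^ b * (r ^ K + 1 / r ^ K)"
    using r by (intro mult_left_mono) auto
  ultimately show ?thesis
    using upper unfolding a_def[symmetric] b_def[symmetric] by (simp add: abs_le_iff algebra_simps)
qed

lemma has_sum_sum:
  fixes f :: "'i \<Rightarrow> 'k \<Rightarrow> real"
  assumes "finite I" "\<And>i. i \<in> I \<Longrightarrow> (f i has_sum s i) A"
  shows "((\<lambda>k. \<Sum>i\<in>I. f i k) has_sum (\<Sum>i\<in>I. s i)) A"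
  using assms by (induction I) (auto intro: has_sum_add)

lemma L2_set_sum_le:
  assumes "finite D"
  shows "L2_set (\<lambda>i. \<Sum>m\<in>D. f m i) F \<le> (\<Sum>m\<in>D. L2_set (f m) F)"
  using assms
proof (induction D)
  case empty
  then show ?case
    by (simp add: L2_set_def)
next
  case (insert m D)
  have "L2_set (\<lambda>i. \<Sum>m\<in>insert m D. f m i) F = L2_set (\<lambda>i. f m i + (\<Sum>m\<in>D. f m i)) F"
    using insert by simp
  also have "\<dots> \<le> L2_set (f m) F + L2_set (\<lambda>i. \<Sum>m\<in>D. f m i) F"
    by (rule L2_set_triangle_ineq)
  finally show ?case
    using insert by simp
qed

lemma L2_set_abs_mono:
  assumes "\<And>i. i \<in> F \<Longrightarrow> \<bar>f i\<bar> \<le> \<bar>g i\<bar>"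
  shows "L2_set f F \<le> L2_set g F"
  unfolding L2_set_def using assms by (intro real_sqrt_le_mono sum_mono) (simp add: abs_le_square_iff)

lemma (in positive_toeplitz) L2_lower_bound:
  assumes "finite F"
  shows "c * L2_set x F \<le> L2_set (\<lambda>i. \<Sum>j\<in>F. R (i - j) * x j) F"
proof (cases "L2_set x F = 0")
  case True
  then show ?thesis
    by simp
next
  case False
  let ?y = "\<lambda>i. \<Sum>j\<in>F. R (i - j) * x j"
  have "c * (L2_set x F)\<^sup>2 \<le> (\<Sum>i\<in>F. x i * ?y i)"
    using coercive[OF assms, of x] by (simp add: L2_set_def sum_nonneg)
  also have "\<dots> \<le> (\<Sum>i\<in>F. \<bar>x i\<bar> * \<bar>?y i\<bar>)"
    by (intro sum_mono) (simp add: abs_mult[symmetric])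
  also have "\<dots> \<le> L2_set x F * L2_set ?y F"
    by (rule L2_set_mult_ineq)
  finally have "L2_set x F * (c * L2_set x F) \<le> L2_set x F * L2_set ?y F"
    by (simp add: power2_eq_square mult_ac)
  then show ?thesis
    using False by (simp add: less_le[of 0])
qed

lemma infsum_shift_int:
  fixes f :: "int \<Rightarrow> real"
  shows "(\<Sum>\<^sub>\<infinity>k. f (k - m)) = (\<Sum>\<^sub>\<infinity>k. f k)"
    and "(\<lambda>k. f (k - m)) summable_on UNIV \<longleftrightarrow> f summable_on UNIV"
proof -
  have bij: "bij_betw (\<lambda>k. k - m) UNIV UNIV"
    by (rule bij_betw_byWitness[where f' = "\<lambda>k. k + m"]) auto
  show "(\<Sum>\<^sub>\<infinity>k. f (k - m)) = (\<Sum>\<^sub>\<infinity>k. f k)"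
    by (rule infsum_reindex_bij_betw[OF bij])
  show "(\<lambda>k. f (k - m)) summable_on UNIV \<longleftrightarrow> f summable_on UNIV"
    by (rule summable_on_reindex_bij_betw[OF bij])
qed

context positive_toeplitz
begin

text \<open>
  Let \<open>w\<^sub>k\<close> be the weight \<open>r ^ \<bar>j - k\<bar>\<close> and \<open>q k\<close> the Euclidean norm of \<open>w\<^sub>k x\<close>. The sum of
  \<open>q k\<close> over all integers \<open>k\<close> and the summable norm of \<open>x\<close> bound each other up to constants. The
  Euclidean lower bound gives \<open>c * q k \<le> \<parallel>w\<^sub>k T x\<parallel> + \<parallel>[T, w\<^sub>k] x\<parallel>\<close>. Split the commutator along the
  diagonals \<open>m\<close> of \<open>T\<close>: a diagonal near the main one contributes at most \<open>\<bar>R m\<bar> * \<eta> * q k\<close>, as the weight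
  varies slowly, and a distant one at most \<open>\<bar>R m\<bar> * (q (k - m) + q k)\<close>. After summation over \<open>k\<close>
  the shift by \<open>m\<close> disappears, and the commutators amount to at most half of
  \<open>c * (\<Sum>k. q k)\<close>, which is absorbed on the left.
\<close>

lemma l1_stability:
  "\<exists>C\<ge>0. \<forall>F x. finite F \<longrightarrow> (\<Sum>i\<in>F. \<bar>x i\<bar>) \<le> C * (\<Sum>i\<in>F. \<bar>\<Sum>j\<in>F. R (i - j) * x j\<bar>)"
proof -
  define \<rho> where "\<rho> = (\<Sum>\<^sub>\<infinity>k. \<bar>R k\<bar>)"
  have \<rho>: "0 \<le> \<rho>" "\<And>D. finite D \<Longrightarrow> (\<Sum>k\<in>D. \<bar>R k\<bar>) \<le> \<rho>"
    unfolding \<rho>_def using R_summable by (auto intro!: infsum_nonneg finite_sum_le_infsum)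
  obtain D0 where D0: "finite D0" "\<And>E. finite E \<Longrightarrow> (\<Sum>k\<in>E - D0. \<bar>R k\<bar>) \<le> c / 8"
    using abs_summable_tail_small[OF R_summable, of "c / 8"] c_pos by auto
  obtain K :: nat where K: "\<And>m. m \<in> D0 \<Longrightarrow> \<bar>m\<bar> \<le> int K"
  proof
    fix m assume m: "m \<in> D0"
    have "nat \<bar>m\<bar> \<le> (\<Sum>m\<in>D0. nat \<bar>m\<bar>)"
      using m D0(1) by (intro member_le_sum) auto
    then show "\<bar>m\<bar> \<le> int (\<Sum>m\<in>D0. nat \<bar>m\<bar>)"
      by linarith
  qed
  have "((\<lambda>r::real. (1 / r ^ K - 1) * \<rho>) \<longlongrightarrow> (1 / 1 ^ K - 1) * \<rho>) (at_left 1)"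
    by (intro tendsto_intros) auto
  then have "\<forall>\<^sub>F r in at_left 1. (1 / r ^ K - 1) * \<rho> < c / 4"
    using c_pos by (intro order_tendstoD(2)[of _ 0]) auto
  moreover have "\<forall>\<^sub>F r in at_left 1. (0::real) < r \<and> r < 1"
    using eventually_at_left_real[of 0 1] by (auto elim: eventually_mono)
  ultimately obtain r :: real where r: "0 < r" "r < 1" "(1 / r ^ K - 1) * \<rho> < c / 4"
    using eventually_happens'[OF _ eventually_conj] trivial_limit_at_left_real by blast
  define \<eta> where "\<eta> = 1 / r ^ K - 1"
  have \<eta>: "0 \<le> \<eta>"
    using r power_le_one[of r K] by (simp add: \<eta>_def)
  define w where "w j = r ^ nat \<bar>j\<bar>" for j :: int
  have w: "0 < w j" "w 0 = 1" for j
    using r by (auto simp: w_def)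
  have w_sum: "w summable_on UNIV"
    unfolding w_def by (rule summable_on_two_sided_geometric) (use r in auto)
  define W where "W = (\<Sum>\<^sub>\<infinity>k. w k)"
  have W: "0 \<le> W"
    unfolding W_def using w(1) by (intro infsum_nonneg) (simp add: less_imp_le)
  have w_refl: "w (- j) = w j" for j
    by (simp add: w_def)
  have w_translate: "(\<lambda>k. w (i - k)) summable_on UNIV" "(\<Sum>\<^sub>\<infinity>k. w (i - k)) = W" for i
  proof -
    have "w (i - k) = w (k - i)" for k
      using w_refl[of "k - i"] by simp
    then show "(\<lambda>k. w (i - k)) summable_on UNIV" "(\<Sum>\<^sub>\<infinity>k. w (i - k)) = W"
      using infsum_shift_int[of w i] w_sum by (auto simp: W_def)
  qed
  have "(\<Sum>i\<in>F. \<bar>x i\<bar>) \<le> 2 * W / c * (\<Sum>i\<in>F. \<bar>\<Sum>j\<in>F. R (i - j) * x j\<bar>)"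
    if F: "finite F" for F and x :: "int \<Rightarrow> real"
  proof -
    define y where "y i = (\<Sum>j\<in>F. R (i - j) * x j)" for i
    \<comment> \<open>\<open>N m k\<close> is the contribution of the \<open>m\<close>-th diagonal to the commutator with \<open>w\<^sub>k\<close>, without the factor \<open>R m\<close>.\<close>
    define q where "q k = L2_set (\<lambda>j. w (j - k) * x j) F" for k
    define N where "N m k = L2_set (\<lambda>j. (w (j + m - k) - w (j - k)) * x j) F" for m k
    define D where "D = (\<lambda>(i, j). i - j) ` (F \<times> F)"
    have D: "finite D" "\<And>i j. i \<in> F \<Longrightarrow> j \<in> F \<Longrightarrow> i - j \<in> D"
      using F by (auto simp: D_def)
    have weighted_le: "L2_set (\<lambda>j. w (j - k) * z j) F \<le> (\<Sum>j\<in>F. w (j - k) * \<bar>z j\<bar>)" for k and z :: "int \<Rightarrow> real"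
      using L2_set_le_sum_abs[of "\<lambda>j. w (j - k) * z j" F] w(1) by (simp add: abs_mult less_imp_le)
    have weighted_summable: "(\<lambda>k. \<Sum>j\<in>F. w (j - k) * \<bar>z j\<bar>) summable_on UNIV"
      and weighted_sum: "(\<Sum>\<^sub>\<infinity>k. \<Sum>j\<in>F. w (j - k) * \<bar>z j\<bar>) = W * (\<Sum>j\<in>F. \<bar>z j\<bar>)" for z :: "int \<Rightarrow> real"
    proof -
      have "((\<lambda>k. \<Sum>j\<in>F. w (j - k) * \<bar>z j\<bar>) has_sum (\<Sum>j\<in>F. W * \<bar>z j\<bar>)) UNIV"
        using w_translate by (intro has_sum_sum F has_sum_cmult_left) (simp add: has_sum_iff)
      then show "(\<lambda>k. \<Sum>j\<in>F. w (j - k) * \<bar>z j\<bar>) summable_on UNIV"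
        "(\<Sum>\<^sub>\<infinity>k. \<Sum>j\<in>F. w (j - k) * \<bar>z j\<bar>) = W * (\<Sum>j\<in>F. \<bar>z j\<bar>)"
        by (auto simp: has_sum_iff sum_distrib_left)
    qed
    have q_sum: "q summable_on UNIV"
      by (rule summable_on_comparison_test[OF weighted_summable[of x]])
         (auto simp: q_def weighted_le)
    define Q where "Q = (\<Sum>\<^sub>\<infinity>k. q k)"
    have N_far: "N m k \<le> q (k - m) + q k" for m k
    proof -
      have "N m k \<le> L2_set (\<lambda>j. \<bar>w (j + m - k) * x j\<bar> + \<bar>w (j - k) * x j\<bar>) F"
        unfolding N_def by (intro L2_set_abs_mono) (auto simp: algebra_simps)
      also have "\<dots> \<le> L2_set (\<lambda>j. \<bar>w (j + m - k) * x j\<bar>) F + L2_set (\<lambda>j. \<bar>w (j - k) * x j\<bar>) F"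
        by (rule L2_set_triangle_ineq)
      also have "\<dots> = q (k - m) + q k"
        by (simp add: q_def L2_set_def algebra_simps)
      finally show ?thesis .
    qed
    have N_near: "N m k \<le> \<eta> * q k" if "\<bar>m\<bar> \<le> int K" for m k
    proof -
      have "N m k \<le> L2_set (\<lambda>j. \<eta> * (w (j - k) * x j)) F"
        unfolding N_def
      proof (intro L2_set_abs_mono)
        fix j
        have "\<bar>w (j - k + m) - w (j - k)\<bar> \<le> \<eta> * w (j - k)"
          unfolding w_def \<eta>_def by (rule geometric_weight_diff) (use r that in auto)
        then have "\<bar>w (j - k + m) - w (j - k)\<bar> * \<bar>x j\<bar> \<le> \<eta> * w (j - k) * \<bar>x j\<bar>"
          by (rule mult_right_mono) simp
        then show "\<bar>(w (j + m - k) - w (j - k)) * x j\<bar> \<le> \<bar>\<eta> * (w (j - k) * x j)\<bar>"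
          using \<eta> w(1)[of "j - k"] by (simp add: abs_mult mult.assoc diff_add_eq)
      qed
      also have "\<dots> = \<eta> * q k"
        unfolding q_def by (rule L2_set_right_distrib[OF \<eta>, symmetric])
      finally show ?thesis .
    qed
    have N_sum: "N m summable_on UNIV" for m
      by (rule summable_on_comparison_test[OF summable_on_add[OF iffD2[OF infsum_shift_int(2), OF q_sum, of m] q_sum]])
         (use N_far in \<open>auto simp: N_def\<close>)
    define \<theta> where "\<theta> m = (if m \<in> D0 then \<eta> else 2)" for m
    have N_infsum: "(\<Sum>\<^sub>\<infinity>k. N m k) \<le> \<theta> m * Q" for m
    proof (cases "m \<in> D0")
      case True
      have "(\<Sum>\<^sub>\<infinity>k. N m k) \<le> (\<Sum>\<^sub>\<infinity>k. \<eta> * q k)"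
        using N_near K[OF True] by (intro infsum_mono N_sum summable_on_cmult_right q_sum) auto
      then show ?thesis
        using True q_sum by (simp add: \<theta>_def Q_def infsum_cmult_right)
    next
      case False
      have "(\<Sum>\<^sub>\<infinity>k. N m k) \<le> (\<Sum>\<^sub>\<infinity>k. q (k - m) + q k)"
        using N_far by (intro infsum_mono N_sum summable_on_add q_sum) (auto simp: infsum_shift_int(2) q_sum)
      also have "\<dots> = 2 * Q"
        by (subst infsum_add) (auto simp: infsum_shift_int q_sum Q_def)
      finally show ?thesis
        using False by (simp add: \<theta>_def)
    qed
    have pointwise: "c * q k \<le> (\<Sum>j\<in>F. w (j - k) * \<bar>y j\<bar>) + (\<Sum>m\<in>D. \<bar>R m\<bar> * N m k)" for k
    proof -
      define E where "E i = (\<Sum>j\<in>F. R (i - j) * ((w (j - k) - w (i - k)) * x j))" for i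
      \<comment> \<open>Extending \<open>x\<close> by zero lets \<open>m\<close> range over all of \<open>D\<close>, whichever row \<open>i\<close> is considered.\<close>
      define x' where "x' j = (if j \<in> F then x j else 0)" for j
      have "c * q k \<le> L2_set (\<lambda>i. \<Sum>j\<in>F. R (i - j) * (w (j - k) * x j)) F"
        unfolding q_def by (rule L2_lower_bound[OF F])
      also have "\<dots> = L2_set (\<lambda>i. w (i - k) * y i + E i) F"
        unfolding y_def E_def sum_distrib_left sum.distrib[symmetric]
        by (intro L2_set_cong refl sum.cong) (simp add: algebra_simps)
      also have "\<dots> \<le> L2_set (\<lambda>i. w (i - k) * y i) F + L2_set E F"
        by (rule L2_set_triangle_ineq)
      also have "L2_set E F \<le> L2_set (\<lambda>i. \<Sum>m\<in>D. \<bar>R m\<bar> * \<bar>(w (i - m - k) - w (i - k)) * x' (i - m)\<bar>) F"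
      proof (intro L2_set_abs_mono)
        fix i assume i: "i \<in> F"
        have "\<bar>E i\<bar> \<le> (\<Sum>j\<in>F. \<bar>R (i - j)\<bar> * \<bar>(w (j - k) - w (i - k)) * x j\<bar>)"
          unfolding E_def by (rule order.trans[OF sum_abs]) (simp add: abs_mult)
        also have "\<dots> = (\<Sum>m\<in>(\<lambda>j. i - j) ` F. \<bar>R m\<bar> * \<bar>(w (i - m - k) - w (i - k)) * x' (i - m)\<bar>)"
          by (subst sum.reindex) (auto simp: inj_on_def x'_def)
        also have "\<dots> \<le> (\<Sum>m\<in>D. \<bar>R m\<bar> * \<bar>(w (i - m - k) - w (i - k)) * x' (i - m)\<bar>)"
          using D i by (intro sum_mono2) auto
        finally show "\<bar>E i\<bar> \<le> \<bar>\<Sum>m\<in>D. \<bar>R m\<bar> * \<bar>(w (i - m - k) - w (i - k)) * x' (i - m)\<bar>\<bar>"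
          by linarith
      qed
      also have "\<dots> \<le> (\<Sum>m\<in>D. L2_set (\<lambda>i. \<bar>R m\<bar> * \<bar>(w (i - m - k) - w (i - k)) * x' (i - m)\<bar>) F)"
        by (rule L2_set_sum_le[OF D(1)])
      also have "\<dots> \<le> (\<Sum>m\<in>D. \<bar>R m\<bar> * N m k)"
      proof (intro sum_mono)
        fix m
        have "(\<Sum>i\<in>F. ((w (i - m - k) - w (i - k)) * x' (i - m))\<^sup>2) =
            (\<Sum>j\<in>(\<lambda>i. i - m) ` F. ((w (j - k) - w (j + m - k)) * x' j)\<^sup>2)"
          by (subst sum.reindex) (auto simp: inj_on_def)
        also have "\<dots> = (\<Sum>j\<in>(\<lambda>i. i - m) ` F \<inter> F. ((w (j - k) - w (j + m - k)) * x' j)\<^sup>2)"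
          using F by (intro sum.mono_neutral_right) (auto simp: x'_def)
        also have "\<dots> \<le> (\<Sum>j\<in>F. ((w (j - k) - w (j + m - k)) * x' j)\<^sup>2)"
          using F by (intro sum_mono2) auto
        also have "\<dots> = (\<Sum>j\<in>F. ((w (j + m - k) - w (j - k)) * x j)\<^sup>2)"
          by (intro sum.cong refl) (simp add: x'_def power2_eq_square algebra_simps)
        finally have "L2_set (\<lambda>i. \<bar>(w (i - m - k) - w (i - k)) * x' (i - m)\<bar>) F \<le> N m k"
          unfolding N_def L2_set_def by (intro real_sqrt_le_mono) simp
        then show "L2_set (\<lambda>i. \<bar>R m\<bar> * \<bar>(w (i - m - k) - w (i - k)) * x' (i - m)\<bar>) F \<le> \<bar>R m\<bar> * N m k"
          by (simp add: L2_set_right_distrib[symmetric] mult_left_mono)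
      qed
      finally show ?thesis
        using weighted_le[of k y] by linarith
    qed
    have rhs: "((\<lambda>k. (\<Sum>j\<in>F. w (j - k) * \<bar>y j\<bar>) + (\<Sum>m\<in>D. \<bar>R m\<bar> * N m k)) has_sum
        (W * (\<Sum>j\<in>F. \<bar>y j\<bar>) + (\<Sum>m\<in>D. \<bar>R m\<bar> * (\<Sum>\<^sub>\<infinity>k. N m k)))) UNIV"
      using weighted_summable weighted_sum N_sum
      by (intro has_sum_add has_sum_sum D(1) has_sum_cmult_right) (auto simp: has_sum_iff)
    have "c * Q = (\<Sum>\<^sub>\<infinity>k. c * q k)"
      using q_sum by (simp add: Q_def infsum_cmult_right)
    also have "\<dots> \<le> W * (\<Sum>j\<in>F. \<bar>y j\<bar>) + (\<Sum>m\<in>D. \<bar>R m\<bar> * (\<Sum>\<^sub>\<infinity>k. N m k))"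
      using rhs pointwise by (intro has_sum_mono[OF _ rhs, of "\<lambda>k. c * q k"] has_sum_infsum summable_on_cmult_right q_sum) auto
    also have "(\<Sum>m\<in>D. \<bar>R m\<bar> * (\<Sum>\<^sub>\<infinity>k. N m k)) \<le> (\<Sum>m\<in>D. \<bar>R m\<bar> * (\<theta> m * Q))"
      using N_infsum by (intro sum_mono mult_left_mono) auto
    also have "\<dots> = (\<Sum>m\<in>D. \<bar>R m\<bar> * \<theta> m) * Q"
      by (simp add: sum_distrib_right mult.assoc)
    also have "\<dots> \<le> c / 2 * Q"
    proof (rule mult_right_mono)
      have "(\<Sum>m\<in>D. \<bar>R m\<bar> * \<theta> m) = (\<Sum>m\<in>D \<inter> D0. \<bar>R m\<bar> * \<theta> m) + (\<Sum>m\<in>D - D0. \<bar>R m\<bar> * \<theta> m)"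
        using D(1) by (subst sum.union_disjoint[symmetric]) (auto intro!: sum.cong)
      also have "\<dots> = (\<Sum>m\<in>D \<inter> D0. \<bar>R m\<bar>) * \<eta> + (\<Sum>m\<in>D - D0. \<bar>R m\<bar>) * 2"
        by (simp add: \<theta>_def sum_distrib_right)
      also have "\<dots> \<le> \<rho> * \<eta> + c / 8 * 2"
        using D(1) D0 \<rho> \<eta> by (intro add_mono mult_right_mono) auto
      also have "\<rho> * \<eta> \<le> c / 4"
        using r(3) unfolding \<eta>_def by (subst mult.commute) simp
      finally show "(\<Sum>m\<in>D. \<bar>R m\<bar> * \<theta> m) \<le> c / 2"
        by simp
      show "0 \<le> Q"
        unfolding Q_def q_def by (intro infsum_nonneg) simp
    qed
    finally have Q_le: "Q \<le> 2 * W / c * (\<Sum>j\<in>F. \<bar>y j\<bar>)"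
      using c_pos by (simp add: field_simps)
    have "(\<Sum>i\<in>F. \<bar>x i\<bar>) \<le> (\<Sum>k\<in>F. q k)"
    proof (intro sum_mono)
      fix k assume k: "k \<in> F"
      have "\<bar>w (k - k) * x k\<bar> \<le> L2_set (\<lambda>j. \<bar>w (j - k) * x j\<bar>) F"
        using F k by (rule member_le_L2_set)
      then show "\<bar>x k\<bar> \<le> q k"
        by (simp add: q_def w L2_set_def)
    qed
    also have "\<dots> \<le> Q"
      unfolding Q_def by (intro finite_sum_le_infsum q_sum F) (auto simp: q_def)
    finally show ?thesis
      using Q_le by (simp add: y_def)
  qed
  moreover have "0 \<le> 2 * W / c"
    using W c_pos by simp
  ultimately show ?thesis
    by (intro exI[of _ "2 * W / c"]) auto
qed

end

section \<open>Finite sections and the Wiener-Hopf equation\<close>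

context positive_toeplitz
begin

text \<open>
  Adding one index \<open>s\<close> to \<open>F\<close>: there is a vector \<open>v\<close> with \<open>v s = 1\<close> that the enlarged matrix sends to a
  multiple \<open>d\<close> of the unit vector at \<open>s\<close>, and \<open>d > 0\<close> by coercivity. A multiple of \<open>v\<close>
  corrects the row \<open>s\<close> without changing the rows already solved.
\<close>

lemma finite_system_solvable:
  assumes "finite F"
  shows "\<exists>x. \<forall>i\<in>F. (\<Sum>j\<in>F. R (i - j) * x j) = b i"
  using assms
proof (induction F arbitrary: b)
  case empty
  then show ?case
    by simp
next
  case (insert s F)
  obtain g where g: "\<And>i. i \<in> F \<Longrightarrow> (\<Sum>j\<in>F. R (i - j) * g j) = R (i - s)"
    using insert.IH[of "\<lambda>i. R (i - s)"] by blast
  obtain y where y: "\<And>i. i \<in> F \<Longrightarrow> (\<Sum>j\<in>F. R (i - j) * y j) = b i"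
    using insert.IH[of b] by blast
  define v where "v j = (if j = s then 1 else - g j)" for j
  define d where "d = (\<Sum>j\<in>insert s F. R (s - j) * v j)"
  have sum_s: "(\<Sum>j\<in>insert s F. h j) = h s + (\<Sum>j\<in>F. h j)" for h :: "int \<Rightarrow> real"
    using insert.hyps by simp
  have off_s: "(\<Sum>j\<in>F. R (i - j) * (if j = s then \<alpha> else h j)) = (\<Sum>j\<in>F. R (i - j) * h j)" for i h \<alpha>
    using insert.hyps by (intro sum.cong) auto
  have v_F: "(\<Sum>j\<in>insert s F. R (i - j) * v j) = 0" if "i \<in> F" for i
    using g[OF that] by (simp add: sum_s v_def off_s sum_negf)
  have "c * (v s)\<^sup>2 \<le> c * (\<Sum>i\<in>insert s F. (v i)\<^sup>2)"
    using c_pos insert.hyps by (intro mult_left_mono member_le_sum) auto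
  also have "\<dots> \<le> (\<Sum>i\<in>insert s F. v i * (\<Sum>j\<in>insert s F. R (i - j) * v j))"
    by (rule coercive) (use insert.hyps in simp)
  also have "\<dots> = d"
    unfolding sum_s[of "\<lambda>i. v i * _ i"] using v_F by (simp add: d_def v_def[of s])
  finally have d: "0 < d"
    using c_pos by (simp add: v_def)
  define y' where "y' j = (if j = s then 0 else y j)" for j
  define t where "t = (b s - (\<Sum>j\<in>insert s F. R (s - j) * y' j)) / d"
  have "(\<Sum>j\<in>insert s F. R (i - j) * (y' j + t * v j)) = b i" if i: "i \<in> insert s F" for i
  proof -
    have "(\<Sum>j\<in>insert s F. R (i - j) * (y' j + t * v j)) =
        (\<Sum>j\<in>insert s F. R (i - j) * y' j) + t * (\<Sum>j\<in>insert s F. R (i - j) * v j)"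
      unfolding sum_distrib_left sum.distrib[symmetric]
      by (intro sum.cong refl) (simp add: algebra_simps)
    also have "\<dots> = b i"
    proof (cases "i = s")
      case True
      then show ?thesis
        using d by (simp add: d_def[symmetric] t_def)
    next
      case False
      then have "i \<in> F"
        using i by simp
      then show ?thesis
        using v_F[of i] y[of i] unfolding sum_s by (simp add: y'_def off_s)
    qed
    finally show ?thesis .
  qed
  then show ?case
    by (intro exI[of _ "\<lambda>j. y' j + t * v j"]) blast
qed

lemma coercive_nat:
  "c * (\<Sum>i\<le>p. (z i)\<^sup>2) \<le> (\<Sum>i\<le>p. z i * (\<Sum>j\<le>p. R (int i - int j) * z j))"
  using coercive[of "int ` {..p}" "\<lambda>i. z (nat i)"] by (simp add: sum.reindex)

lemma l1_stability_nat:
  "\<exists>C\<ge>0. \<forall>p z. (\<Sum>i\<le>p. \<bar>z i\<bar>) \<le> C * (\<Sum>i\<le>p. \<bar>\<Sum>j\<le>p. R (int i - int j) * z j\<bar>)"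
proof -
  obtain C where C: "0 \<le> C"
    "\<forall>F x. finite F \<longrightarrow> (\<Sum>i\<in>F. \<bar>x i\<bar>) \<le> C * (\<Sum>i\<in>F. \<bar>\<Sum>j\<in>F. R (i - j) * x j\<bar>)"
    using l1_stability by (elim exE conjE)
  have "(\<Sum>i\<le>p. \<bar>z i\<bar>) \<le> C * (\<Sum>i\<le>p. \<bar>\<Sum>j\<le>p. R (int i - int j) * z j\<bar>)" for p z
    using C(2)[rule_format, of "int ` {..p}" "\<lambda>i. z (nat i)"] by (simp add: sum.reindex)
  then show ?thesis
    using C(1) by (intro exI[of _ C]) simp
qed

text \<open>
  The first column of the inverse of the section on \<open>0..p\<close>, padded with zeros so that sections of
  different orders can be compared.
\<close>

definition inverse_column :: "nat \<Rightarrow> nat \<Rightarrow> real" where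
  "inverse_column p = (SOME u. (\<forall>j>p. u j = 0) \<and>
     (\<forall>i\<le>p. (\<Sum>j\<le>p. R (int i - int j) * u j) = of_bool (i = 0)))"

lemma inverse_column_props:
  "(\<forall>j>p. inverse_column p j = 0) \<and>
   (\<forall>i\<le>p. (\<Sum>j\<le>p. R (int i - int j) * inverse_column p j) = of_bool (i = 0))"
proof -
  obtain x where x: "\<forall>i\<in>int ` {..p}. (\<Sum>j\<in>int ` {..p}. R (i - j) * x j) = of_bool (i = 0)"
    using finite_system_solvable[of "int ` {..p}" "\<lambda>i. of_bool (i = 0)"] by auto
  define u where "u j = (if j \<le> p then x (int j) else 0)" for j :: nat
  have "(\<forall>j>p. u j = 0) \<and> (\<forall>i\<le>p. (\<Sum>j\<le>p. R (int i - int j) * u j) = of_bool (i = 0))"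
    using x by (simp add: u_def sum.reindex)
  then show ?thesis
    unfolding inverse_column_def
    by (rule someI[where P = "\<lambda>u. (\<forall>j>p. u j = 0) \<and>
      (\<forall>i\<le>p. (\<Sum>j\<le>p. R (int i - int j) * u j) = of_bool (i = 0))"])
qed

lemma inverse_column_eq_0: "p < j \<Longrightarrow> inverse_column p j = 0"
  using inverse_column_props by blast

lemma inverse_column_eq:
  "i \<le> p \<Longrightarrow> (\<Sum>j\<le>p. R (int i - int j) * inverse_column p j) = of_bool (i = 0)"
  using inverse_column_props by blast

text \<open>
  The solution of order \<open>p\<close> is the Galerkin approximation of the one of order \<open>q\<close>: their difference \<open>z\<close>
  satisfies \<open>T z = 0\<close> in the rows \<open>0..p\<close>, so it is orthogonal to the smaller solution in the
  energy form, and its own energy is \<open>z 0\<close>. Consequently the entries at \<open>0\<close> increase with \<open>p\<close> and control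
  all other entries.
\<close>

lemma inverse_column_diff:
  assumes "p \<le> q"
  shows "c * (\<Sum>j\<le>q. (inverse_column q j - inverse_column p j)\<^sup>2) \<le>
    inverse_column q 0 - inverse_column p 0"
proof -
  let ?u = inverse_column
  define z where "z j = ?u q j - ?u p j" for j
  define Tz where "Tz i = (\<Sum>j\<le>q. R (int i - int j) * z j)" for i :: nat
  have Tz: "Tz i = of_bool (i = 0) - (\<Sum>j\<le>q. R (int i - int j) * ?u p j)" if "i \<le> q" for i
    using inverse_column_eq[OF that] by (simp add: Tz_def z_def right_diff_distrib sum_subtractf)
  have Tz_0: "Tz i = 0" if "i \<le> p" for i
  proof -
    have "(\<Sum>j\<le>q. R (int i - int j) * ?u p j) = (\<Sum>j\<le>p. R (int i - int j) * ?u p j)"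
      using assms inverse_column_eq_0 by (intro sum.mono_neutral_right) auto
    then show ?thesis
      using Tz[of i] inverse_column_eq[OF that] that assms by simp
  qed
  have "(\<Sum>i\<le>q. z i * Tz i) = (\<Sum>i\<le>q. z i * of_bool (i = 0)) - (\<Sum>i\<le>q. z i * (\<Sum>j\<le>q. R (int i - int j) * ?u p j))"
    unfolding sum_subtractf[symmetric] by (intro sum.cong refl) (simp add: Tz right_diff_distrib)
  also have "(\<Sum>i\<le>q. z i * (\<Sum>j\<le>q. R (int i - int j) * ?u p j)) = (\<Sum>j\<le>q. ?u p j * Tz j)"
  proof -
    have "R (int i - int j) = R (int j - int i)" for i j
      using R_even[of "int j - int i"] by simp
    then show ?thesis
      unfolding Tz_def sum_distrib_left
      by (subst sum.swap) (intro sum.cong refl, simp add: mult_ac)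
  qed
  also have "(\<Sum>j\<le>q. ?u p j * Tz j) = 0"
  proof (rule sum.neutral, rule ballI)
    fix j
    show "?u p j * Tz j = 0"
      using Tz_0[of j] inverse_column_eq_0[of p j] by (cases "j \<le> p") auto
  qed
  also have "(\<Sum>i\<le>q. z i * of_bool (i = 0)) = z 0"
    by (simp add: of_bool_def if_distrib[of "\<lambda>t. _ * t"] sum.delta cong: if_cong)
  finally have "(\<Sum>i\<le>q. z i * Tz i) = z 0"
    by simp
  then show ?thesis
    using coercive_nat[of z q] by (simp add: Tz_def z_def)
qed

lemma inverse_column_0_mono: "p \<le> q \<Longrightarrow> inverse_column p 0 \<le> inverse_column q 0"
proof -
  assume "p \<le> q"
  moreover have "0 \<le> c * (\<Sum>j\<le>q. (inverse_column q j - inverse_column p j)\<^sup>2)"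
    using c_pos by (simp add: sum_nonneg)
  ultimately show ?thesis
    using inverse_column_diff by fastforce
qed

lemma inverse_column_0_pos: "0 < inverse_column 0 0"
proof -
  have "c \<le> R 0"
    using coercive[of "{0}" "\<lambda>_. 1"] by simp
  moreover have "R 0 * inverse_column 0 0 = 1"
    using inverse_column_eq[of 0 0] by simp
  ultimately show ?thesis
    using c_pos by (metis less_le_trans zero_less_mult_pos zero_less_one)
qed

lemma inverse_column_l1_bound: "\<exists>B. \<forall>p. (\<Sum>j\<le>p. \<bar>inverse_column p j\<bar>) \<le> B"
proof -
  obtain C where C: "0 \<le> C"
    "\<forall>p z. (\<Sum>i\<le>p. \<bar>z i\<bar>) \<le> C * (\<Sum>i\<le>p. \<bar>\<Sum>j\<le>p. R (int i - int j) * z j\<bar>)"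
    using l1_stability_nat by (elim exE conjE)
  have "(\<Sum>j\<le>p. \<bar>inverse_column p j\<bar>) \<le> C" for p
  proof -
    have "(\<Sum>i\<le>p. \<bar>\<Sum>j\<le>p. R (int i - int j) * inverse_column p j\<bar>) = (\<Sum>i\<le>p. if i = 0 then 1 else 0)"
      by (intro sum.cong refl) (simp add: inverse_column_eq)
    then show ?thesis
      using C(2)[rule_format, of "inverse_column p" p] by (simp add: sum.delta)
  qed
  then show ?thesis
    by blast
qed

lemma abs_sum_le_member:
  fixes f :: "nat \<Rightarrow> real"
  assumes "j \<le> p"
  shows "\<bar>f j\<bar> \<le> (\<Sum>j\<le>p. \<bar>f j\<bar>)"
  using assms by (intro member_le_sum) auto

text \<open>
  The entries at \<open>0\<close> are increasing and bounded, hence Cauchy, and the energy estimate passes this on to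
  every other entry.
\<close>

lemma inverse_column_convergent: "convergent (\<lambda>p. inverse_column p j)"
proof -
  let ?u = inverse_column
  obtain B where B: "\<And>p. (\<Sum>j\<le>p. \<bar>?u p j\<bar>) \<le> B"
    using inverse_column_l1_bound by blast
  have "?u p 0 \<le> B" for p
    using abs_sum_le_member[of 0 p "?u p"] B[of p] by linarith
  moreover have "incseq (\<lambda>p. ?u p 0)"
    using inverse_column_0_mono by (simp add: incseq_def)
  ultimately obtain L where "(\<lambda>p. ?u p 0) \<longlonglongrightarrow> L"
    using incseq_convergent[of "\<lambda>p. ?u p 0" B] by blast
  then have "convergent (\<lambda>p. ?u p 0)"
    by (rule convergentI)
  then have cauchy: "Cauchy (\<lambda>p. ?u p 0)"
    by (rule convergent_Cauchy)
  have step: "(?u q j - ?u p j)\<^sup>2 \<le> (?u q 0 - ?u p 0) / c" if "p \<le> q" for p q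
  proof (cases "j \<le> q")
    case True
    have "c * (?u q j - ?u p j)\<^sup>2 \<le> c * (\<Sum>j\<le>q. (?u q j - ?u p j)\<^sup>2)"
      using True c_pos by (intro mult_left_mono member_le_sum) auto
    also have "\<dots> \<le> ?u q 0 - ?u p 0"
      by (rule inverse_column_diff[OF that])
    finally show ?thesis
      using c_pos by (simp add: field_simps)
  next
    case False
    then show ?thesis
      using that inverse_column_eq_0 inverse_column_0_mono[OF that] c_pos by simp
  qed
  have "Cauchy (\<lambda>p. ?u p j)"
  proof (rule CauchyI')
    fix e :: real assume "0 < e"
    then have "0 < c * e\<^sup>2"
      using c_pos by simp
    then obtain N where N: "\<And>p q. N \<le> p \<Longrightarrow> N \<le> q \<Longrightarrow> norm (?u p 0 - ?u q 0) < c * e\<^sup>2"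
      using CauchyD[OF cauchy] by metis
    have "norm (?u p j - ?u q j) < e" if "N \<le> p" "p < q" for p q
    proof -
      have "(?u q j - ?u p j)\<^sup>2 \<le> (?u q 0 - ?u p 0) / c"
        using step that by simp
      also have "\<dots> < e\<^sup>2"
        using N[of p q] that c_pos by (simp add: field_simps)
      finally have "\<bar>?u q j - ?u p j\<bar> < e"
        using \<open>0 < e\<close> by (intro power2_less_imp_less[of "\<bar>_\<bar>" e]) auto
      then show ?thesis
        by (simp add: abs_minus_commute)
    qed
    then show "\<exists>M. \<forall>m\<ge>M. \<forall>n>m. dist (?u m j) (?u n j) < e"
      unfolding dist_norm by blast
  qed
  then show ?thesis
    by (rule Cauchy_convergent)
qed

text \<open>
  Up to a constant factor these are the coefficients that turn the process into its innovations.
\<close>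

definition limit_column :: "nat \<Rightarrow> real" where
  "limit_column j = lim (\<lambda>p. inverse_column p j)"

lemma inverse_column_LIMSEQ: "(\<lambda>p. inverse_column p j) \<longlonglongrightarrow> limit_column j"
  unfolding limit_column_def using inverse_column_convergent by (simp add: convergent_LIMSEQ_iff)

lemma limit_column_0_pos: "0 < limit_column 0"
proof -
  have "inverse_column 0 0 \<le> limit_column 0"
    by (rule LIMSEQ_le_const[OF inverse_column_LIMSEQ]) (use inverse_column_0_mono in auto)
  then show ?thesis
    using inverse_column_0_pos by linarith
qed

lemma limit_column_summable: "summable (\<lambda>j. \<bar>limit_column j\<bar>)"
proof -
  obtain B where B: "\<And>p. (\<Sum>j\<le>p. \<bar>inverse_column p j\<bar>) \<le> B"
    using inverse_column_l1_bound by blast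
  have "(\<Sum>j\<le>n. \<bar>limit_column j\<bar>) \<le> B" for n
  proof (rule LIMSEQ_le_const2)
    show "(\<lambda>p. \<Sum>j\<le>n. \<bar>inverse_column p j\<bar>) \<longlonglongrightarrow> (\<Sum>j\<le>n. \<bar>limit_column j\<bar>)"
      by (intro tendsto_sum tendsto_rabs inverse_column_LIMSEQ)
    have "(\<Sum>j\<le>n. \<bar>inverse_column p j\<bar>) \<le> B" if "n \<le> p" for p
      using B[of p] sum_mono2[of "{..p}" "{..n}" "\<lambda>j. \<bar>inverse_column p j\<bar>"] that by simp
    then show "\<exists>N. \<forall>p\<ge>N. (\<Sum>j\<le>n. \<bar>inverse_column p j\<bar>) \<le> B"
      by blast
  qed
  then show ?thesis
    by (intro bounded_imp_summable[where B = B]) auto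
qed

lemma R_row_summable: "summable (\<lambda>j. \<bar>R (i - int j)\<bar>)"
proof -
  have "(\<lambda>k. \<bar>R k\<bar>) summable_on range (\<lambda>j. i - int j)"
    using R_summable by (rule summable_on_subset_banach) auto
  then have "(\<lambda>j. \<bar>R (i - int j)\<bar>) summable_on UNIV"
    by (subst (asm) summable_on_reindex) (auto simp: inj_def o_def)
  then show ?thesis
    by (rule summable_on_imp_summable)
qed

text \<open>
  Dominated convergence in the finite systems: the solutions are uniformly bounded and \<open>R\<close> is summable.
\<close>

lemma wiener_hopf:
  "(\<lambda>j. R (int i - int j) * limit_column j) sums of_bool (i = 0)"
proof -
  let ?u = inverse_column
  obtain B where B: "\<And>p. (\<Sum>j\<le>p. \<bar>?u p j\<bar>) \<le> B"
    using inverse_column_l1_bound by blast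
  have B_nonneg: "0 \<le> B"
    using B[of 0] by (simp add: order.trans[OF abs_ge_zero])
  have bound: "\<bar>?u p j\<bar> \<le> B" for p j
  proof (cases "j \<le> p")
    case True
    then show ?thesis
      using abs_sum_le_member[of j p "?u p"] B[of p] by linarith
  next
    case False
    then show ?thesis
      using inverse_column_eq_0 B_nonneg by simp
  qed
  have dominated: "norm (R (int i - int j) * ?u p j) \<le> \<bar>R (int i - int j)\<bar> * B" for j p
    using bound by (simp add: abs_mult mult_left_mono)
  have T: "eventually (\<lambda>p. summable (\<lambda>j. norm (R (int i - int j) * ?u p j))) sequentially \<and>
      summable (\<lambda>j. norm (R (int i - int j) * limit_column j)) \<and>
      (\<lambda>p. \<Sum>j. R (int i - int j) * ?u p j) \<longlonglongrightarrow> (\<Sum>j. R (int i - int j) * limit_column j)"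
    by (rule tannerys_theorem[where M = "\<lambda>j. \<bar>R (int i - int j)\<bar> * B"])
       (auto intro!: tendsto_mult tendsto_const inverse_column_LIMSEQ always_eventually
          summable_mult2 R_row_summable dominated[simplified])
  have "(\<Sum>j. R (int i - int j) * ?u p j) = of_bool (i = 0)" if "i \<le> p" for p
  proof -
    have "(\<Sum>j. R (int i - int j) * ?u p j) = (\<Sum>j\<le>p. R (int i - int j) * ?u p j)"
      by (intro suminf_finite) (auto simp: inverse_column_eq_0)
    then show ?thesis
      using inverse_column_eq[OF that] by simp
  qed
  then have "(\<lambda>p. \<Sum>j. R (int i - int j) * ?u p j) \<longlonglongrightarrow> of_bool (i = 0)"
    by (intro tendsto_eventually eventually_sequentiallyI[of i])
  then have "(\<Sum>j. R (int i - int j) * limit_column j) = of_bool (i = 0)"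
    using T LIMSEQ_unique by blast
  moreover have "summable (\<lambda>j. R (int i - int j) * limit_column j)"
    by (rule summable_norm_cancel[OF T[THEN conjunct2, THEN conjunct1]])
  ultimately show ?thesis
    by (simp add: sums_iff)
qed

text \<open>
  In the rows \<open>0..p\<close> the truncation of the limit misses the right-hand side only by the terms beyond \<open>p\<close>,
  whose summable norm is at most \<open>\<rho>\<close> times a tail of the limit. Stability of the sections
  turns this into a bound for the distance between the finite solution and the truncation.
\<close>

lemma inverse_column_sum_LIMSEQ:
  "(\<lambda>p. \<Sum>j\<le>p. inverse_column p j) \<longlonglongrightarrow> (\<Sum>j. limit_column j)"
proof -
  let ?u = inverse_column and ?v = limit_column
  define \<rho> where "\<rho> = (\<Sum>\<^sub>\<infinity>k. \<bar>R k\<bar>)"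
  obtain C where C: "0 \<le> C"
    "\<forall>p z. (\<Sum>i\<le>p. \<bar>z i\<bar>) \<le> C * (\<Sum>i\<le>p. \<bar>\<Sum>j\<le>p. R (int i - int j) * z j\<bar>)"
    using l1_stability_nat by (elim exE conjE)
  define tail where "tail p = (\<Sum>j. \<bar>?v (j + Suc p)\<bar>)" for p
  have tail_LIMSEQ: "tail \<longlonglongrightarrow> 0"
    unfolding tail_def by (intro LIMSEQ_Suc suminf_exist_split2 limit_column_summable)
  have tail_summable: "summable (\<lambda>j. \<bar>?v (j + Suc p)\<bar>)" for p
    using summable_ignore_initial_segment[OF limit_column_summable] .
  have close: "\<bar>(\<Sum>j\<le>p. ?u p j) - (\<Sum>j\<le>p. ?v j)\<bar> \<le> C * (\<rho> * tail p)" for p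
  proof -
    have row: "(\<Sum>j\<le>p. R (int i - int j) * (?u p j - ?v j)) = (\<Sum>j. R (int i - int (j + Suc p)) * ?v (j + Suc p))"
      if "i \<le> p" for i
    proof -
      have "(\<lambda>j. R (int i - int (j + Suc p)) * ?v (j + Suc p)) sums
          (of_bool (i = 0) - (\<Sum>j<Suc p. R (int i - int j) * ?v j))"
        using sums_split_initial_segment[OF wiener_hopf[of i], of "Suc p"] .
      moreover have "(\<Sum>j\<le>p. R (int i - int j) * (?u p j - ?v j)) =
          of_bool (i = 0) - (\<Sum>j<Suc p. R (int i - int j) * ?v j)"
        using inverse_column_eq[OF that] by (simp add: right_diff_distrib sum_subtractf lessThan_Suc_atMost)
      ultimately show ?thesis
        by (simp add: sums_iff)
    qed
    have R_le: "(\<Sum>i\<le>p. \<bar>R (int i - m)\<bar>) \<le> \<rho>" for m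
    proof -
      have "(\<Sum>i\<le>p. \<bar>R (int i - m)\<bar>) = (\<Sum>k\<in>(\<lambda>i. int i - m) ` {..p}. \<bar>R k\<bar>)"
        by (subst sum.reindex) (auto simp: inj_on_def)
      also have "\<dots> \<le> \<rho>"
        unfolding \<rho>_def using R_summable by (intro finite_sum_le_infsum) auto
      finally show ?thesis .
    qed
    have summ: "summable (\<lambda>j. \<bar>R (int i - int (j + Suc p))\<bar> * \<bar>?v (j + Suc p)\<bar>)" for i
    proof (rule summable_comparison_test'[of "\<lambda>j. \<rho> * \<bar>?v (j + Suc p)\<bar>" 0])
      show "summable (\<lambda>j. \<rho> * \<bar>?v (j + Suc p)\<bar>)"
        by (intro summable_mult tail_summable)
      have "\<bar>R k\<bar> \<le> \<rho>" for k
        unfolding \<rho>_def using finite_sum_le_infsum[OF R_summable, of "{k}"] by simp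
      then show "norm (\<bar>R (int i - int (j + Suc p))\<bar> * \<bar>?v (j + Suc p)\<bar>) \<le> \<rho> * \<bar>?v (j + Suc p)\<bar>" for j
        by (simp add: abs_mult mult_right_mono)
    qed
    have "\<bar>(\<Sum>j\<le>p. ?u p j) - (\<Sum>j\<le>p. ?v j)\<bar> \<le> (\<Sum>j\<le>p. \<bar>?u p j - ?v j\<bar>)"
      unfolding sum_subtractf[symmetric] by (rule sum_abs)
    also have "\<dots> \<le> C * (\<Sum>i\<le>p. \<bar>\<Sum>j\<le>p. R (int i - int j) * (?u p j - ?v j)\<bar>)"
      by (rule C(2)[rule_format])
    also have "\<dots> \<le> C * (\<Sum>i\<le>p. \<Sum>j. \<bar>R (int i - int (j + Suc p))\<bar> * \<bar>?v (j + Suc p)\<bar>)"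
    proof (intro mult_left_mono C(1) sum_mono)
      fix i assume "i \<in> {..p}"
      then have "\<bar>\<Sum>j\<le>p. R (int i - int j) * (?u p j - ?v j)\<bar> =
          \<bar>\<Sum>j. R (int i - int (j + Suc p)) * ?v (j + Suc p)\<bar>"
        using row by simp
      also have "\<dots> \<le> (\<Sum>j. \<bar>R (int i - int (j + Suc p)) * ?v (j + Suc p)\<bar>)"
        using summ[of i] by (intro summable_rabs) (simp add: abs_mult)
      finally show "\<bar>\<Sum>j\<le>p. R (int i - int j) * (?u p j - ?v j)\<bar> \<le>
          (\<Sum>j. \<bar>R (int i - int (j + Suc p))\<bar> * \<bar>?v (j + Suc p)\<bar>)"
        by (simp add: abs_mult)
    qed
    also have "(\<Sum>i\<le>p. \<Sum>j. \<bar>R (int i - int (j + Suc p))\<bar> * \<bar>?v (j + Suc p)\<bar>) =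
        (\<Sum>j. \<Sum>i\<le>p. \<bar>R (int i - int (j + Suc p))\<bar> * \<bar>?v (j + Suc p)\<bar>)"
      by (rule suminf_sum[symmetric]) (rule summ)
    also have "\<dots> \<le> (\<Sum>j. \<rho> * \<bar>?v (j + Suc p)\<bar>)"
      using R_le
      by (intro suminf_le summable_sum summ summable_mult tail_summable)
         (simp add: sum_distrib_right[symmetric] mult_right_mono)
    also have "\<dots> = \<rho> * tail p"
      unfolding tail_def by (rule suminf_mult[OF tail_summable])
    finally show ?thesis
      using C(1) by (simp add: mult_left_mono)
  qed
  have "(\<lambda>p. C * (\<rho> * tail p)) \<longlonglongrightarrow> 0"
    using tendsto_mult_right_zero tail_LIMSEQ by blast
  then have "(\<lambda>p. (\<Sum>j\<le>p. ?u p j) - (\<Sum>j\<le>p. ?v j)) \<longlonglongrightarrow> 0"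
    by (rule Lim_null_comparison[rotated]) (use close in simp)
  moreover have "(\<lambda>p. \<Sum>j\<le>p. ?v j) \<longlonglongrightarrow> (\<Sum>j. ?v j)"
    using limit_column_summable summable_rabs_cancel summable_LIMSEQ' by blast
  ultimately show ?thesis
    using tendsto_add by fastforce
qed

end

section \<open>Convolution with a summable one-sided sequence\<close>

text \<open>
  Young's inequality for \<open>\<ell>\<^sup>1\<close>; the total mass of a convolution is the product of the total masses.
\<close>

lemma convolution_abs_summable:
  fixes a :: "nat \<Rightarrow> real" and f :: "int \<Rightarrow> real"
  assumes a: "summable (\<lambda>j. \<bar>a j\<bar>)" and f: "(\<lambda>k. \<bar>f k\<bar>) summable_on UNIV"
  shows "(\<lambda>k. \<bar>\<Sum>j. a j * f (k - int j)\<bar>) summable_on UNIV"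
    and "(\<Sum>\<^sub>\<infinity>k. \<Sum>j. a j * f (k - int j)) = (\<Sum>j. a j) * (\<Sum>\<^sub>\<infinity>k. f k)"
    and "summable (\<lambda>j. \<bar>a j * f (k - int j)\<bar>)"
proof -
  define G where "G = (\<lambda>(j, k). a j * f (k - int j))"
  have f': "f summable_on UNIV"
    using f abs_summable_summable[of f UNIV] by simp
  have row: "(\<Sum>\<^sub>\<infinity>k. norm (G (j, k))) = \<bar>a j\<bar> * (\<Sum>\<^sub>\<infinity>k. \<bar>f k\<bar>)"
    and row_summable: "(\<lambda>k. norm (G (j, k))) summable_on UNIV" for j
    using infsum_shift_int[of "\<lambda>k. \<bar>f k\<bar>" "int j"] f
    by (auto simp: G_def abs_mult infsum_cmult_right summable_on_cmult_right)
  have a': "(\<lambda>j. \<bar>a j\<bar>) summable_on UNIV"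
    using a by (intro norm_summable_imp_summable_on) simp
  have G: "(\<lambda>x. norm (G x)) summable_on UNIV \<times> UNIV"
  proof (rule iffD2[OF Infinite_Sum.abs_summable_on_Sigma_iff], intro conjI ballI)
    show "(\<lambda>k. norm (G (j, k))) summable_on UNIV" for j
      by (rule row_summable)
    show "(\<lambda>j. norm (\<Sum>\<^sub>\<infinity>k. norm (G (j, k)))) summable_on UNIV"
      unfolding row using a' by (simp add: abs_mult summable_on_cmult_left)
  qed
  then have G_swap: "(\<lambda>x. norm (case x of (k, j) \<Rightarrow> G (j, k))) summable_on UNIV \<times> UNIV"
    using summable_on_swap[of "\<lambda>x. norm (G x)" UNIV UNIV] by (simp add: case_prod_unfold)
  then have col: "(\<lambda>j. norm (G (j, k))) summable_on UNIV"
    and col_summable: "(\<lambda>k. \<Sum>\<^sub>\<infinity>j. norm (G (j, k))) summable_on UNIV" for k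
    using iffD1[OF Infinite_Sum.abs_summable_on_Sigma_iff G_swap]
    by (auto simp: infsum_nonneg)
  show summ: "summable (\<lambda>j. \<bar>a j * f (k - int j)\<bar>)" for k
    using summable_on_imp_summable[OF col[of k]] by (simp add: G_def)
  have conv: "(\<Sum>j. a j * f (k - int j)) = (\<Sum>\<^sub>\<infinity>j. G (j, k))" for k
  proof -
    have "((\<lambda>j. G (j, k)) has_sum (\<Sum>j. a j * f (k - int j))) UNIV"
      using summ[of k] by (intro norm_summable_imp_has_sum) (auto simp: G_def dest: summable_rabs_cancel)
    then show ?thesis
      by (simp add: has_sum_iff)
  qed
  show "(\<lambda>k. \<bar>\<Sum>j. a j * f (k - int j)\<bar>) summable_on UNIV"
    by (rule summable_on_comparison_test[OF col_summable])
       (use norm_infsum_bound[OF col] in \<open>auto simp: conv\<close>)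
  have "(\<Sum>\<^sub>\<infinity>k. \<Sum>j. a j * f (k - int j)) = (\<Sum>\<^sub>\<infinity>j. \<Sum>\<^sub>\<infinity>k. G (j, k))"
    unfolding conv using abs_summable_summable[OF G_swap] by (intro infsum_swap_banach) simp
  also have "\<dots> = (\<Sum>\<^sub>\<infinity>j. a j * (\<Sum>\<^sub>\<infinity>k. f k))"
    using f' by (simp add: G_def infsum_cmult_right infsum_shift_int)
  also have "\<dots> = (\<Sum>\<^sub>\<infinity>j. a j) * (\<Sum>\<^sub>\<infinity>k. f k)"
    by (rule infsum_cmult_left')
  also have "(\<Sum>\<^sub>\<infinity>j. a j) = (\<Sum>j. a j)"
    using a norm_summable_imp_has_sum[of a "\<Sum>j. a j"] by (auto simp: has_sum_iff dest: summable_rabs_cancel)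
  finally show "(\<Sum>\<^sub>\<infinity>k. \<Sum>j. a j * f (k - int j)) = (\<Sum>j. a j) * (\<Sum>\<^sub>\<infinity>k. f k)" .
qed

section \<open>Square-integrable functions and orthogonal projections\<close>

lemma square_integrableD:
  assumes "Y \<in> square_integrable M"
  shows "Y \<in> borel_measurable M" "integrable M (\<lambda>\<omega>. (Y \<omega>)\<^sup>2)"
  using assms by (auto simp: square_integrable_def)

lemma abs_mult_le_half_squares: "\<bar>x * y\<bar> \<le> (x\<^sup>2 + y\<^sup>2) / 2" for x y :: real
proof -
  have "0 \<le> (\<bar>x\<bar> - \<bar>y\<bar>)\<^sup>2"
    by simp
  then show ?thesis
    by (simp add: power2_diff abs_mult)
qed

lemma square_integrable_mult:
  assumes "Y \<in> square_integrable M" "Z \<in> square_integrable M"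
  shows "integrable M (\<lambda>\<omega>. Y \<omega> * Z \<omega>)"
    and "(\<integral>\<omega>. \<bar>Y \<omega> * Z \<omega>\<bar> \<partial>M) \<le> ((\<integral>\<omega>. (Y \<omega>)\<^sup>2 \<partial>M) + (\<integral>\<omega>. (Z \<omega>)\<^sup>2 \<partial>M)) / 2"
proof -
  note [measurable] = square_integrableD(1)[OF assms(1)] square_integrableD(1)[OF assms(2)]
  note int = square_integrableD(2)[OF assms(1)] square_integrableD(2)[OF assms(2)]
  show I: "integrable M (\<lambda>\<omega>. Y \<omega> * Z \<omega>)"
    by (rule Bochner_Integration.integrable_bound[where f = "\<lambda>\<omega>. ((Y \<omega>)\<^sup>2 + (Z \<omega>)\<^sup>2) / 2"])
       (use int abs_mult_le_half_squares in auto)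
  have "(\<integral>\<omega>. \<bar>Y \<omega> * Z \<omega>\<bar> \<partial>M) \<le> (\<integral>\<omega>. ((Y \<omega>)\<^sup>2 + (Z \<omega>)\<^sup>2) / 2 \<partial>M)"
    by (rule integral_mono) (use int I abs_mult_le_half_squares in auto)
  also have "\<dots> = ((\<integral>\<omega>. (Y \<omega>)\<^sup>2 \<partial>M) + (\<integral>\<omega>. (Z \<omega>)\<^sup>2 \<partial>M)) / 2"
    using int by simp
  finally show "(\<integral>\<omega>. \<bar>Y \<omega> * Z \<omega>\<bar> \<partial>M) \<le> ((\<integral>\<omega>. (Y \<omega>)\<^sup>2 \<partial>M) + (\<integral>\<omega>. (Z \<omega>)\<^sup>2 \<partial>M)) / 2" .
qed

lemma square_integrable_diff:
  assumes "Y \<in> square_integrable M" "Z \<in> square_integrable M"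
  shows "(\<lambda>\<omega>. Y \<omega> - Z \<omega>) \<in> square_integrable M"
proof -
  note [measurable] = square_integrableD(1)[OF assms(1)] square_integrableD(1)[OF assms(2)]
  have "integrable M (\<lambda>\<omega>. (Y \<omega>)\<^sup>2 - 2 * (Y \<omega> * Z \<omega>) + (Z \<omega>)\<^sup>2)"
    by (intro Bochner_Integration.integrable_add Bochner_Integration.integrable_diff
        Bochner_Integration.integrable_mult_right square_integrable_mult(1) square_integrableD(2) assms)
  then show ?thesis
    by (simp add: square_integrable_def power2_diff algebra_simps)
qed

lemma square_integrable_lin_span:
  assumes "\<And>k. k \<in> I \<Longrightarrow> X k \<in> square_integrable M"
  shows "lin_span X I \<subseteq> square_integrable M"
proof
  fix W assume "W \<in> lin_span X I"
  then obtain F c where F: "finite F" "F \<subseteq> I" and W: "W = (\<lambda>\<omega>. \<Sum>k\<in>F. c k * X k \<omega>)"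
    by (auto simp: lin_span_def)
  have X: "X k \<in> square_integrable M" if "k \<in> F" for k
    using that F(2) assms by auto
  have "integrable M (\<lambda>\<omega>. \<Sum>k\<in>F. \<Sum>l\<in>F. (c k * c l) * (X k \<omega> * X l \<omega>))"
    by (intro Bochner_Integration.integrable_sum Bochner_Integration.integrable_mult_right square_integrable_mult(1) X)
  then have "integrable M (\<lambda>\<omega>. (\<Sum>k\<in>F. c k * X k \<omega>)\<^sup>2)"
    unfolding power2_eq_square sum_product by (simp add: mult_ac)
  moreover have "W \<in> borel_measurable M"
    unfolding W by (intro borel_measurable_sum borel_measurable_times borel_measurable_const square_integrableD(1)[OF X])
  ultimately show "W \<in> square_integrable M"
    by (simp add: square_integrable_def W)
qed

lemma orthogonal_lin_span:
  assumes X: "\<And>k. k \<in> I \<Longrightarrow> X k \<in> square_integrable M" and V: "V \<in> square_integrable M"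
    and orth: "\<And>k. k \<in> I \<Longrightarrow> (\<integral>\<omega>. V \<omega> * X k \<omega> \<partial>M) = 0"
    and W: "W \<in> lin_span X I"
  shows "(\<integral>\<omega>. V \<omega> * W \<omega> \<partial>M) = 0"
proof -
  obtain F c where F: "finite F" "F \<subseteq> I" and W: "W = (\<lambda>\<omega>. \<Sum>k\<in>F. c k * X k \<omega>)"
    using W by (auto simp: lin_span_def)
  have "(\<integral>\<omega>. V \<omega> * W \<omega> \<partial>M) = (\<integral>\<omega>. (\<Sum>k\<in>F. c k * (V \<omega> * X k \<omega>)) \<partial>M)"
    by (simp add: W sum_distrib_left mult_ac)
  also have "\<dots> = (\<Sum>k\<in>F. (\<integral>\<omega>. c k * (V \<omega> * X k \<omega>) \<partial>M))"
    using F(2) by (intro Bochner_Integration.integral_sum Bochner_Integration.integrable_mult_right square_integrable_mult(1) V X) auto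
  also have "\<dots> = 0"
    using F(2) orth by (intro sum.neutral) auto
  finally show ?thesis .
qed

lemma orthogonal_closed_lin_span:
  assumes X: "\<And>k. k \<in> I \<Longrightarrow> X k \<in> square_integrable M" and V: "V \<in> square_integrable M"
    and orth: "\<And>k. k \<in> I \<Longrightarrow> (\<integral>\<omega>. V \<omega> * X k \<omega> \<partial>M) = 0"
    and W: "W \<in> closed_lin_span M X I"
  shows "(\<integral>\<omega>. V \<omega> * W \<omega> \<partial>M) = 0"
proof (rule ccontr)
  assume nz: "(\<integral>\<omega>. V \<omega> * W \<omega> \<partial>M) \<noteq> 0"
  define d where "d = \<bar>\<integral>\<omega>. V \<omega> * W \<omega> \<partial>M\<bar>"
  define s where "s = (\<integral>\<omega>. (V \<omega>)\<^sup>2 \<partial>M)"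
  have s: "0 \<le> s"
    by (simp add: s_def)
  \<comment> \<open>Scaling \<open>V\<close> by \<open>e\<close> makes the elementary inequality \<open>2ab \<le> a\<^sup>2 + b\<^sup>2\<close> do the work of
    Cauchy-Schwarz.\<close>
  define e where "e = d / (s + 1)"
  have e: "0 < e" "e * (s + 1) = d"
    using nz s by (auto simp: e_def d_def)
  have approx: "\<forall>e>0. \<exists>Z\<in>lin_span X I. (\<integral>\<omega>. (W \<omega> - Z \<omega>)\<^sup>2 \<partial>M) < e"
    using W by (simp add: closed_lin_span_def)
  obtain Z where Z: "Z \<in> lin_span X I" "(\<integral>\<omega>. (W \<omega> - Z \<omega>)\<^sup>2 \<partial>M) < e\<^sup>2"
    using approx[rule_format, of "e\<^sup>2"] e(1) by auto
  have sq: "W \<in> square_integrable M" "Z \<in> square_integrable M"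
    using W Z(1) square_integrable_lin_span[of I X M] X by (auto simp: closed_lin_span_def)
  have eV: "(\<lambda>\<omega>. e * V \<omega>) \<in> square_integrable M"
    using V by (auto simp: square_integrable_def power_mult_distrib)
  have "(\<integral>\<omega>. V \<omega> * W \<omega> \<partial>M) = (\<integral>\<omega>. V \<omega> * W \<omega> - V \<omega> * Z \<omega> \<partial>M)"
    using orthogonal_lin_span[OF X V orth Z(1)] square_integrable_mult(1)[OF V] sq by simp
  also have "\<dots> = (\<integral>\<omega>. V \<omega> * (W \<omega> - Z \<omega>) \<partial>M)"
    by (simp add: right_diff_distrib)
  finally have "e * d = \<bar>\<integral>\<omega>. (e * V \<omega>) * (W \<omega> - Z \<omega>) \<partial>M\<bar>"
    using e(1) by (simp add: d_def abs_mult mult.assoc)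
  also have "\<dots> \<le> (\<integral>\<omega>. \<bar>(e * V \<omega>) * (W \<omega> - Z \<omega>)\<bar> \<partial>M)"
    by (rule integral_abs_bound)
  also have "\<dots> \<le> ((\<integral>\<omega>. (e * V \<omega>)\<^sup>2 \<partial>M) + (\<integral>\<omega>. (W \<omega> - Z \<omega>)\<^sup>2 \<partial>M)) / 2"
    by (rule square_integrable_mult(2)[OF eV square_integrable_diff[OF sq]])
  also have "\<dots> \<le> (e\<^sup>2 * s + e\<^sup>2) / 2"
    using Z(2) by (simp add: power_mult_distrib s_def)
  also have "\<dots> = e * (e * (s + 1)) / 2"
    by (simp add: power2_eq_square algebra_simps)
  finally have "e * d \<le> e * d / 2"
    unfolding e(2) .
  then show False
    using e(1) nz by (simp add: d_def)
qed

text \<open>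
  Any admissible element determines the chosen one almost surely, because the difference \<open>P - Z\<close> of two such
  elements is orthogonal to both \<open>P\<close> and \<open>Z\<close>, hence to itself.
\<close>

lemma orth_proj_AE_eq:
  assumes H: "H \<subseteq> square_integrable M" and Y: "Y \<in> square_integrable M"
    and Z: "Z \<in> H" "\<And>W. W \<in> H \<Longrightarrow> (\<integral>\<omega>. (Y \<omega> - Z \<omega>) * W \<omega> \<partial>M) = 0"
  shows "orth_proj M H Y \<in> square_integrable M" "AE \<omega> in M. orth_proj M H Y \<omega> = Z \<omega>"
proof -
  define P where "P = orth_proj M H Y"
  have "P \<in> H \<and> (\<forall>W\<in>H. (\<integral>\<omega>. (Y \<omega> - P \<omega>) * W \<omega> \<partial>M) = 0)"
    unfolding P_def orth_proj_def by (rule someI[where x = Z]) (use Z in blast)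
  then have P: "P \<in> H" "\<And>W. W \<in> H \<Longrightarrow> (\<integral>\<omega>. (Y \<omega> - P \<omega>) * W \<omega> \<partial>M) = 0"
    by auto
  have sq: "P \<in> square_integrable M" "Z \<in> square_integrable M"
    using P(1) Z(1) H by auto
  have orth: "(\<integral>\<omega>. (P \<omega> - Z \<omega>) * W \<omega> \<partial>M) = 0" if W: "W \<in> H" for W
  proof -
    have "W \<in> square_integrable M"
      using H W by auto
    then have int: "integrable M (\<lambda>\<omega>. (Y \<omega> - Z \<omega>) * W \<omega>)" "integrable M (\<lambda>\<omega>. (Y \<omega> - P \<omega>) * W \<omega>)"
      by (intro square_integrable_mult(1) square_integrable_diff Y sq; assumption)+
    have "(\<integral>\<omega>. (P \<omega> - Z \<omega>) * W \<omega> \<partial>M) = (\<integral>\<omega>. (Y \<omega> - Z \<omega>) * W \<omega> - (Y \<omega> - P \<omega>) * W \<omega> \<partial>M)"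
      by (simp add: algebra_simps)
    then show ?thesis
      using int P(2)[OF W] Z(2)[OF W] by simp
  qed
  have int: "integrable M (\<lambda>\<omega>. (P \<omega> - Z \<omega>) * P \<omega>)" "integrable M (\<lambda>\<omega>. (P \<omega> - Z \<omega>) * Z \<omega>)"
    by (intro square_integrable_mult(1) square_integrable_diff sq)+
  have sq_int: "integrable M (\<lambda>\<omega>. (P \<omega> - Z \<omega>)\<^sup>2)"
    by (rule square_integrableD(2)[OF square_integrable_diff[OF sq]])
  have "(\<integral>\<omega>. (P \<omega> - Z \<omega>)\<^sup>2 \<partial>M) = (\<integral>\<omega>. (P \<omega> - Z \<omega>) * P \<omega> - (P \<omega> - Z \<omega>) * Z \<omega> \<partial>M)"
    by (simp add: power2_eq_square right_diff_distrib)
  also have "\<dots> = 0"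
    using int orth[OF P(1)] orth[OF Z(1)] by simp
  finally have "AE \<omega> in M. (P \<omega> - Z \<omega>)\<^sup>2 = 0"
    using integral_nonneg_eq_0_iff_AE[OF sq_int] by simp
  then show "AE \<omega> in M. orth_proj M H Y \<omega> = Z \<omega>"
    by (simp add: P_def)
  show "orth_proj M H Y \<in> square_integrable M"
    using sq(1) by (simp add: P_def)
qed

lemma wss_AE_cong:
  assumes Y: "\<And>n. Y n \<in> square_integrable M" "\<And>n. AE \<omega> in M. Y n \<omega> = Y' n \<omega>"
    and wss: "zero_mean_wss M Y'"
  shows "zero_mean_wss M Y" "cov_seq M Y = cov_seq M Y'"
proof -
  have Y': "Y' n \<in> square_integrable M" for n
    using wss by (simp add: zero_mean_wss_def)
  note [measurable] = square_integrableD(1)[OF Y(1)] square_integrableD(1)[OF Y']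
  have cov: "(\<integral>\<omega>. Y m \<omega> * Y n \<omega> \<partial>M) = (\<integral>\<omega>. Y' m \<omega> * Y' n \<omega> \<partial>M)" for m n
    by (rule integral_cong_AE) (use Y(2)[of m] Y(2)[of n] in auto)
  have mean: "(\<integral>\<omega>. Y n \<omega> \<partial>M) = (\<integral>\<omega>. Y' n \<omega> \<partial>M)" for n
    by (rule integral_cong_AE) (use Y(2)[of n] in auto)
  show "zero_mean_wss M Y"
    using wss Y(1) unfolding zero_mean_wss_def cov mean by blast
  show "cov_seq M Y = cov_seq M Y'"
    by (simp add: cov_seq_def cov fun_eq_iff)
qed

lemma spectral_density_0:
  assumes "(\<lambda>k. \<bar>cov_seq M Y k\<bar>) summable_on UNIV"
  shows "spectral_density M Y 0 = (\<Sum>\<^sub>\<infinity>k. cov_seq M Y k)"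
proof -
  have "cov_seq M Y summable_on UNIV"
    using assms abs_summable_summable[of "cov_seq M Y" UNIV] by simp
  then have "((\<lambda>k. complex_of_real (cov_seq M Y k)) has_sum of_real (\<Sum>\<^sub>\<infinity>k. cov_seq M Y k)) UNIV"
    by (intro has_sum_of_real has_sum_infsum)
  then show ?thesis
    by (simp add: spectral_density_def has_sum_iff)
qed

section \<open>Summable filters of a stationary process\<close>

text \<open>
  The second claim comes from summing \<open>\<bar>a j\<bar> * (s * \<bar>x j\<bar> - y)\<^sup>2 \<ge> 0\<close>, where \<open>s = \<Sum>j. \<bar>a j\<bar>\<close> and
  \<open>y = \<Sum>j. \<bar>a j * x j\<bar>\<close>.
\<close>

lemma weighted_cauchy_schwarz:
  fixes a x :: "nat \<Rightarrow> real"
  assumes a: "summable (\<lambda>j. \<bar>a j\<bar>)" and ax2: "summable (\<lambda>j. \<bar>a j\<bar> * (x j)\<^sup>2)"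
  shows "summable (\<lambda>j. \<bar>a j * x j\<bar>)"
    and "(\<Sum>j. a j * x j)\<^sup>2 \<le> (\<Sum>j. \<bar>a j\<bar>) * (\<Sum>j. \<bar>a j\<bar> * (x j)\<^sup>2)"
proof -
  show ax: "summable (\<lambda>j. \<bar>a j * x j\<bar>)"
  proof (rule summable_comparison_test'[of "\<lambda>j. \<bar>a j\<bar> + \<bar>a j\<bar> * (x j)\<^sup>2" 0])
    show "summable (\<lambda>j. \<bar>a j\<bar> + \<bar>a j\<bar> * (x j)\<^sup>2)"
      by (intro summable_add a ax2)
    fix j
    have "\<bar>1 * x j\<bar> \<le> (1\<^sup>2 + (x j)\<^sup>2) / 2"
      by (rule abs_mult_le_half_squares)
    then have "\<bar>x j\<bar> \<le> 1 + (x j)\<^sup>2"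
      by (simp add: field_simps)
    then have "\<bar>a j\<bar> * \<bar>x j\<bar> \<le> \<bar>a j\<bar> * (1 + (x j)\<^sup>2)"
      by (rule mult_left_mono) simp
    then show "norm \<bar>a j * x j\<bar> \<le> \<bar>a j\<bar> + \<bar>a j\<bar> * (x j)\<^sup>2"
      by (simp add: abs_mult algebra_simps)
  qed
  define s y z where "s = (\<Sum>j. \<bar>a j\<bar>)" and "y = (\<Sum>j. \<bar>a j * x j\<bar>)" and "z = (\<Sum>j. \<bar>a j\<bar> * (x j)\<^sup>2)"
  have s: "0 \<le> s" and y: "0 \<le> y"
    unfolding s_def y_def by (intro suminf_nonneg a ax; simp)+
  have "(\<lambda>j. s\<^sup>2 * (\<bar>a j\<bar> * (x j)\<^sup>2) - 2 * s * y * \<bar>a j * x j\<bar> + y\<^sup>2 * \<bar>a j\<bar>) sums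
      (s\<^sup>2 * z - 2 * s * y * y + y\<^sup>2 * s)"
    unfolding s_def[symmetric] y_def z_def
    by (intro sums_add sums_diff sums_mult summable_sums ax ax2)
       (use a in \<open>simp add: s_def summable_sums\<close>)
  then have "(\<lambda>j. \<bar>a j\<bar> * (s * \<bar>x j\<bar> - y)\<^sup>2) sums (s * (s * z - y\<^sup>2))"
    by (simp add: power2_diff power2_eq_square abs_mult algebra_simps)
  then have "0 \<le> s * (s * z - y\<^sup>2)"
    by (rule sums_le[OF _ sums_zero, rotated]) simp
  moreover have "y = 0" if "s = 0"
  proof -
    have "\<bar>a j\<bar> = 0" for j
      using suminf_eq_zero_iff[OF a] that by (simp add: s_def)
    then show ?thesis
      by (simp add: y_def)
  qed
  ultimately have "y\<^sup>2 \<le> s * z"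
    using s by (cases "s = 0") (auto simp: zero_le_mult_iff)
  moreover have "\<bar>\<Sum>j. a j * x j\<bar> \<le> y"
    unfolding y_def by (rule summable_rabs[OF ax])
  then have "(\<Sum>j. a j * x j)\<^sup>2 \<le> y\<^sup>2"
    by (metis abs_ge_zero power2_abs power_mono)
  ultimately show "(\<Sum>j. a j * x j)\<^sup>2 \<le> (\<Sum>j. \<bar>a j\<bar>) * (\<Sum>j. \<bar>a j\<bar> * (x j)\<^sup>2)"
    by (simp add: s_def z_def)
qed

text \<open>
  If \<open>\<Sum>j. w j * X (n - j)\<close> is orthogonal to a set of past values, then solving for \<open>X n\<close> gives the
  coefficients of its projection onto their span. The coefficient at \<open>0\<close> vanishes, so that only the strict
  past is used.
\<close>

definition prediction_filter :: "(nat \<Rightarrow> real) \<Rightarrow> nat \<Rightarrow> real" where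
  "prediction_filter w j = (if j = 0 then 0 else - w j / w 0)"

lemma prediction_filter_summable:
  assumes "summable (\<lambda>j. \<bar>w j\<bar>)"
  shows "summable (\<lambda>j. \<bar>prediction_filter w j\<bar>)"
  by (rule summable_comparison_test'[OF summable_divide[OF assms, of "\<bar>w 0\<bar>"], of 0])
     (simp add: prediction_filter_def)

lemma prediction_filter_suminf:
  assumes w: "summable (\<lambda>j. \<bar>w j\<bar>)" and w0: "w 0 \<noteq> 0"
  shows "(\<Sum>j. prediction_filter w j) = 1 - (\<Sum>j. w j) / w 0"
proof -
  have "(\<lambda>j. (if j = 0 then 1 else 0) - w j / w 0) sums (1 - (\<Sum>j. w j) / w 0)"
    using w by (intro sums_diff sums_single sums_divide) (simp add: summable_rabs_cancel summable_sums)
  moreover have "(\<lambda>j. (if j = 0 then 1 else 0) - w j / w 0) = prediction_filter w"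
    using w0 by (auto simp: prediction_filter_def)
  ultimately show ?thesis
    by (simp add: sums_iff)
qed

locale wss_process = prob_space M for M :: "'a measure" +
  fixes X :: "int \<Rightarrow> 'a \<Rightarrow> real"
  assumes wss: "zero_mean_wss M X"
begin

lemma square_integrable_X: "X n \<in> square_integrable M"
  using wss by (simp add: zero_mean_wss_def)

lemmas measurable_X [measurable] = square_integrableD(1)[OF square_integrable_X]

lemma covariance: "(\<integral>\<omega>. X m \<omega> * X n \<omega> \<partial>M) = cov_seq M X (m - n)"
proof -
  have "(\<integral>\<omega>. X (n + (m - n)) \<omega> * X n \<omega> \<partial>M) = (\<integral>\<omega>. X (0 + (m - n)) \<omega> * X 0 \<omega> \<partial>M)"
    using wss unfolding zero_mean_wss_def by blast
  then show ?thesis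
    by (simp add: cov_seq_def)
qed

lemma second_moment: "(\<integral>\<omega>. (X n \<omega>)\<^sup>2 \<partial>M) = cov_seq M X 0"
  using covariance[of n n] by (simp add: power2_eq_square)

lemma variance_nonneg: "0 \<le> cov_seq M X 0"
  unfolding second_moment[of 0, symmetric] by simp

text \<open>
  The series is formed pointwise. Outside a null set it converges absolutely for summable \<open>a\<close>, and
  on the null set the value is immaterial.
\<close>

definition linear_filter :: "(nat \<Rightarrow> real) \<Rightarrow> int \<Rightarrow> 'a \<Rightarrow> real" where
  "linear_filter a n \<omega> = (\<Sum>j. a j * X (n - int j) \<omega>)"

lemma measurable_linear_filter [measurable]: "linear_filter a n \<in> borel_measurable M"
  unfolding linear_filter_def[abs_def] by measurable

text \<open>
  By monotone convergence the series of weighted squares has the finite mean \<open>(\<Sum>j. \<bar>a j\<bar>) * cov_seq M X 0\<close>. It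
  dominates the filter itself, which therefore exists almost surely and is square-integrable.
\<close>

lemma AE_weighted_squares_summable:
  assumes a: "summable (\<lambda>j. \<bar>a j\<bar>)"
  shows "AE \<omega> in M. summable (\<lambda>j. \<bar>a j\<bar> * (X (n - int j) \<omega>)\<^sup>2)"
proof -
  let ?f = "\<lambda>j \<omega>. \<bar>a j\<bar> * (X (n - int j) \<omega>)\<^sup>2"
  have "(\<integral>\<^sup>+\<omega>. (\<Sum>j. ennreal (?f j \<omega>)) \<partial>M) = (\<Sum>j. \<integral>\<^sup>+\<omega>. ennreal (?f j \<omega>) \<partial>M)"
    by (rule nn_integral_suminf) measurable
  also have "\<dots> = (\<Sum>j. ennreal (\<bar>a j\<bar> * cov_seq M X 0))"
    using square_integrableD(2)[OF square_integrable_X]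
    by (subst nn_integral_eq_integral) (auto simp: second_moment)
  also have "\<dots> = ennreal (\<Sum>j. \<bar>a j\<bar> * cov_seq M X 0)"
    using summable_mult2[OF a] variance_nonneg by (intro suminf_ennreal2) auto
  also have "\<dots> \<noteq> \<infinity>"
    by simp
  finally have "AE \<omega> in M. (\<Sum>j. ennreal (?f j \<omega>)) \<noteq> \<infinity>"
    by (intro nn_integral_noteq_infinite) auto
  then show ?thesis
    by eventually_elim (auto intro!: summable_suminf_not_top)
qed

lemma weighted_squares_integral:
  assumes a: "summable (\<lambda>j. \<bar>a j\<bar>)"
  shows "integrable M (\<lambda>\<omega>. \<Sum>j. \<bar>a j\<bar> * (X (n - int j) \<omega>)\<^sup>2)"
    and "(\<integral>\<omega>. (\<Sum>j. \<bar>a j\<bar> * (X (n - int j) \<omega>)\<^sup>2) \<partial>M) = (\<Sum>j. \<bar>a j\<bar>) * cov_seq M X 0"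
proof -
  have int: "integrable M (\<lambda>\<omega>. \<bar>a j\<bar> * (X (n - int j) \<omega>)\<^sup>2)" for j
    using square_integrableD(2)[OF square_integrable_X] by simp
  have ae: "AE \<omega> in M. summable (\<lambda>j. norm (\<bar>a j\<bar> * (X (n - int j) \<omega>)\<^sup>2))"
    using AE_weighted_squares_summable[OF a] by (simp add: abs_mult)
  have sum: "summable (\<lambda>j. \<integral>\<omega>. norm (\<bar>a j\<bar> * (X (n - int j) \<omega>)\<^sup>2) \<partial>M)"
    using a by (simp add: abs_mult second_moment summable_mult2)
  show "integrable M (\<lambda>\<omega>. \<Sum>j. \<bar>a j\<bar> * (X (n - int j) \<omega>)\<^sup>2)"
    by (rule integrable_suminf[OF int ae sum])
  have "(\<integral>\<omega>. (\<Sum>j. \<bar>a j\<bar> * (X (n - int j) \<omega>)\<^sup>2) \<partial>M) = (\<Sum>j. \<integral>\<omega>. \<bar>a j\<bar> * (X (n - int j) \<omega>)\<^sup>2 \<partial>M)"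
    by (rule integral_suminf[OF int ae sum])
  also have "\<dots> = (\<Sum>j. \<bar>a j\<bar>) * cov_seq M X 0"
    using suminf_mult2[OF a] by (simp add: second_moment)
  finally show "(\<integral>\<omega>. (\<Sum>j. \<bar>a j\<bar> * (X (n - int j) \<omega>)\<^sup>2) \<partial>M) = (\<Sum>j. \<bar>a j\<bar>) * cov_seq M X 0" .
qed

lemma square_integrable_linear_filter:
  assumes a: "summable (\<lambda>j. \<bar>a j\<bar>)"
  shows "linear_filter a n \<in> square_integrable M"
    and "(\<integral>\<omega>. (linear_filter a n \<omega>)\<^sup>2 \<partial>M) \<le> (\<Sum>j. \<bar>a j\<bar>)\<^sup>2 * cov_seq M X 0"
proof -
  let ?W = "\<lambda>\<omega>. \<Sum>j. \<bar>a j\<bar> * (X (n - int j) \<omega>)\<^sup>2"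
  have bound: "AE \<omega> in M. (linear_filter a n \<omega>)\<^sup>2 \<le> (\<Sum>j. \<bar>a j\<bar>) * ?W \<omega>"
    using AE_weighted_squares_summable[OF a, of n]
    by eventually_elim (simp add: linear_filter_def weighted_cauchy_schwarz(2)[OF a])
  have int_W: "integrable M (\<lambda>\<omega>. (\<Sum>j. \<bar>a j\<bar>) * ?W \<omega>)"
    using weighted_squares_integral(1)[OF a] by simp
  have int: "integrable M (\<lambda>\<omega>. (linear_filter a n \<omega>)\<^sup>2)"
    by (rule Bochner_Integration.integrable_bound[OF int_W]) (use bound in auto)
  then show "linear_filter a n \<in> square_integrable M"
    by (simp add: square_integrable_def)
  have "(\<integral>\<omega>. (linear_filter a n \<omega>)\<^sup>2 \<partial>M) \<le> (\<integral>\<omega>. (\<Sum>j. \<bar>a j\<bar>) * ?W \<omega> \<partial>M)"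
    by (rule integral_mono_AE[OF int int_W bound])
  also have "\<dots> = (\<Sum>j. \<bar>a j\<bar>)\<^sup>2 * cov_seq M X 0"
    unfolding integral_mult_right_zero weighted_squares_integral(2)[OF a]
    by (simp add: power2_eq_square)
  finally show "(\<integral>\<omega>. (linear_filter a n \<omega>)\<^sup>2 \<partial>M) \<le> (\<Sum>j. \<bar>a j\<bar>)\<^sup>2 * cov_seq M X 0" .
qed

lemma AE_linear_filter_sums:
  assumes a: "summable (\<lambda>j. \<bar>a j\<bar>)"
  shows "AE \<omega> in M. summable (\<lambda>j. \<bar>a j * X (n - int j) \<omega>\<bar>) \<and>
    (\<lambda>j. a j * X (n - int j) \<omega>) sums linear_filter a n \<omega>"
  using AE_weighted_squares_summable[OF a, of n]
proof eventually_elim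
  case (elim \<omega>)
  then have "summable (\<lambda>j. \<bar>a j * X (n - int j) \<omega>\<bar>)"
    by (rule weighted_cauchy_schwarz(1)[OF a])
  then show ?case
    by (simp add: linear_filter_def summable_rabs_cancel summable_sums)
qed

lemma linear_filter_inner:
  assumes a: "summable (\<lambda>j. \<bar>a j\<bar>)" and Z: "Z \<in> square_integrable M"
  shows "(\<integral>\<omega>. linear_filter a n \<omega> * Z \<omega> \<partial>M) = (\<Sum>j. a j * (\<integral>\<omega>. X (n - int j) \<omega> * Z \<omega> \<partial>M))"
proof -
  note [measurable] = square_integrableD(1)[OF Z]
  have int: "integrable M (\<lambda>\<omega>. a j * X (n - int j) \<omega> * Z \<omega>)" for j
    using square_integrable_mult(1)[OF square_integrable_X Z] by (simp add: mult.assoc)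
  have ae: "AE \<omega> in M. summable (\<lambda>j. norm (a j * X (n - int j) \<omega> * Z \<omega>))"
    using AE_linear_filter_sums[OF a, of n]
    by eventually_elim (simp add: abs_mult summable_mult2)
  have sum: "summable (\<lambda>j. \<integral>\<omega>. norm (a j * X (n - int j) \<omega> * Z \<omega>) \<partial>M)"
  proof (rule summable_comparison_test')
    let ?C = "(cov_seq M X 0 + (\<integral>\<omega>. (Z \<omega>)\<^sup>2 \<partial>M)) / 2"
    show "summable (\<lambda>j. \<bar>a j\<bar> * ?C)"
      using a by (rule summable_mult2)
    fix j
    have "(\<integral>\<omega>. norm (a j * X (n - int j) \<omega> * Z \<omega>) \<partial>M) = \<bar>a j\<bar> * (\<integral>\<omega>. \<bar>X (n - int j) \<omega> * Z \<omega>\<bar> \<partial>M)"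
      by (simp add: abs_mult mult.assoc)
    also have "\<dots> \<le> \<bar>a j\<bar> * ?C"
      using square_integrable_mult(2)[OF square_integrable_X Z, of "n - int j"]
      by (intro mult_left_mono) (auto simp: second_moment)
    finally show "norm (\<integral>\<omega>. norm (a j * X (n - int j) \<omega> * Z \<omega>) \<partial>M) \<le> \<bar>a j\<bar> * ?C"
      by simp
  qed
  have "(\<integral>\<omega>. linear_filter a n \<omega> * Z \<omega> \<partial>M) = (\<integral>\<omega>. (\<Sum>j. a j * X (n - int j) \<omega> * Z \<omega>) \<partial>M)"
  proof (rule integral_cong_AE)
    show "AE \<omega> in M. linear_filter a n \<omega> * Z \<omega> = (\<Sum>j. a j * X (n - int j) \<omega> * Z \<omega>)"
      using AE_linear_filter_sums[OF a, of n]
      by eventually_elim (auto intro!: sums_unique sums_mult2)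
  qed measurable
  also have "\<dots> = (\<Sum>j. \<integral>\<omega>. a j * X (n - int j) \<omega> * Z \<omega> \<partial>M)"
    by (rule integral_suminf[OF int ae sum])
  also have "\<dots> = (\<Sum>j. a j * (\<integral>\<omega>. X (n - int j) \<omega> * Z \<omega> \<partial>M))"
    by (simp add: mult.assoc)
  finally show ?thesis .
qed

lemma linear_filter_inner_X:
  assumes a: "summable (\<lambda>j. \<bar>a j\<bar>)"
  shows "(\<integral>\<omega>. linear_filter a n \<omega> * X m \<omega> \<partial>M) = (\<Sum>j. a j * cov_seq M X (n - m - int j))"
proof -
  have "n - int j - m = n - m - int j" for j
    by simp
  then show ?thesis
    by (simp only: linear_filter_inner[OF a square_integrable_X] covariance)
qed

lemma linear_filter_inner_linear_filter:
  assumes a: "summable (\<lambda>j. \<bar>a j\<bar>)"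
  shows "(\<integral>\<omega>. linear_filter a m \<omega> * linear_filter a n \<omega> \<partial>M) =
    (\<Sum>j. a j * (\<Sum>l. a l * cov_seq M X (n - m + int j - int l)))"
proof -
  have "(\<integral>\<omega>. X (m - int j) \<omega> * linear_filter a n \<omega> \<partial>M) = (\<Sum>l. a l * cov_seq M X (n - m + int j - int l))" for j
  proof -
    have "(\<integral>\<omega>. X (m - int j) \<omega> * linear_filter a n \<omega> \<partial>M) = (\<integral>\<omega>. linear_filter a n \<omega> * X (m - int j) \<omega> \<partial>M)"
      by (simp add: mult.commute)
    also have "\<dots> = (\<Sum>l. a l * cov_seq M X (n - (m - int j) - int l))"
      by (rule linear_filter_inner_X[OF a])
    finally show ?thesis
      by (simp add: algebra_simps)
  qed
  then show ?thesis
    by (simp add: linear_filter_inner[OF a square_integrable_linear_filter(1)[OF a]])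
qed

theorem linear_filter_wss:
  assumes a: "summable (\<lambda>j. \<bar>a j\<bar>)"
  shows "zero_mean_wss M (linear_filter a)"
proof -
  have "(\<integral>\<omega>. linear_filter a n \<omega> \<partial>M) = 0" for n
  proof -
    have one: "(\<lambda>_. 1) \<in> square_integrable M"
      by (simp add: square_integrable_def)
    have "(\<integral>\<omega>. X k \<omega> \<partial>M) = 0" for k
      using wss by (simp add: zero_mean_wss_def)
    then show ?thesis
      using linear_filter_inner[OF a one, of n] by simp
  qed
  then show ?thesis
    unfolding zero_mean_wss_def linear_filter_inner_linear_filter[OF a]
    using square_integrable_linear_filter(1)[OF a] by simp
qed

text \<open>
  The covariance sequence of the output is \<open>R\<close> convolved with \<open>a\<close> and with the reflection of \<open>a\<close>, and the
  spectral density at \<open>0\<close> is the sum of the covariances.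
\<close>

theorem linear_filter_spectral_density_0:
  assumes a: "summable (\<lambda>j. \<bar>a j\<bar>)" and R: "(\<lambda>k. \<bar>cov_seq M X k\<bar>) summable_on UNIV"
  shows "(\<lambda>k. \<bar>cov_seq M (linear_filter a) k\<bar>) summable_on UNIV"
    and "spectral_density M (linear_filter a) 0 = (\<Sum>j. a j)\<^sup>2 * spectral_density M X 0"
proof -
  define h where "h k = (\<Sum>l. a l * cov_seq M X (k - int l))" for k
  have h: "(\<lambda>k. \<bar>h k\<bar>) summable_on UNIV" "(\<Sum>\<^sub>\<infinity>k. h k) = (\<Sum>j. a j) * (\<Sum>\<^sub>\<infinity>k. cov_seq M X k)"
    unfolding h_def by (rule convolution_abs_summable(1)[OF a R] convolution_abs_summable(2)[OF a R])+
  have bij: "bij_betw uminus UNIV (UNIV :: int set)"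
    by (simp add: bij_uminus)
  have h_refl: "(\<lambda>k. \<bar>h (- k)\<bar>) summable_on UNIV" "(\<Sum>\<^sub>\<infinity>k. h (- k)) = (\<Sum>\<^sub>\<infinity>k. h k)"
    using h(1) summable_on_reindex_bij_betw[OF bij, of "\<lambda>k. \<bar>h k\<bar>"] infsum_reindex_bij_betw[OF bij, of h] by simp_all
  have cov: "cov_seq M (linear_filter a) k = (\<Sum>j. a j * h (- (k - int j)))" for k
    by (simp add: cov_seq_def linear_filter_inner_linear_filter[OF a] h_def)
  show summ: "(\<lambda>k. \<bar>cov_seq M (linear_filter a) k\<bar>) summable_on UNIV"
    unfolding cov by (rule convolution_abs_summable(1)[OF a h_refl(1)])
  have "(\<Sum>\<^sub>\<infinity>k. cov_seq M (linear_filter a) k) = (\<Sum>j. a j) * (\<Sum>\<^sub>\<infinity>k. h (- k))"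
    unfolding cov by (rule convolution_abs_summable(2)[OF a h_refl(1)])
  then show "spectral_density M (linear_filter a) 0 = (\<Sum>j. a j)\<^sup>2 * spectral_density M X 0"
    by (simp add: spectral_density_0[OF summ] spectral_density_0[OF R] h_refl(2) h(2) power2_eq_square)
qed

text \<open>
  Cutting the filter off after \<open>N\<close> coefficients leaves the filter \<open>b\<close> of the remaining ones, whose second
  moment is bounded by the square of \<open>\<Sum>j. \<bar>b j\<bar>\<close>.
\<close>

lemma linear_filter_in_closed_lin_span:
  assumes a: "summable (\<lambda>j. \<bar>a j\<bar>)" and I: "\<And>j. a j \<noteq> 0 \<Longrightarrow> n - int j \<in> I"
  shows "linear_filter a n \<in> closed_lin_span M X I"
proof -
  have "\<exists>Z\<in>lin_span X I. (\<integral>\<omega>. (linear_filter a n \<omega> - Z \<omega>)\<^sup>2 \<partial>M) < e" if e: "0 < e" for e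
  proof -
    define tail where "tail N = (\<Sum>j. \<bar>a (j + N)\<bar>)" for N
    have "(\<lambda>N. (tail N)\<^sup>2 * cov_seq M X 0) \<longlonglongrightarrow> 0\<^sup>2 * cov_seq M X 0"
      unfolding tail_def by (intro tendsto_intros suminf_exist_split2 a)
    then have "\<forall>\<^sub>F N in sequentially. (tail N)\<^sup>2 * cov_seq M X 0 < e"
      using e by (intro order_tendstoD(2)[of _ 0]) auto
    then obtain N where N: "(tail N)\<^sup>2 * cov_seq M X 0 < e"
      by (auto simp: eventually_sequentially)
    define b where "b j = (if j < N then 0 else a j)" for j
    define J where "J = {j. j < N \<and> a j \<noteq> 0}"
    define Z where "Z \<omega> = (\<Sum>k\<in>(\<lambda>j. n - int j) ` J. a (nat (n - k)) * X k \<omega>)" for \<omega>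
    have Z_span: "Z \<in> lin_span X I"
      unfolding lin_span_def Z_def using I
      by (auto simp: J_def fun_eq_iff intro!: exI[of _ "(\<lambda>j. n - int j) ` J"] exI[of _ "\<lambda>k. a (nat (n - k))"])
    have b: "summable (\<lambda>j. \<bar>b j\<bar>)"
      by (rule summable_comparison_test'[OF a, of 0]) (simp add: b_def)
    have Z_eq: "Z \<omega> = (\<Sum>j<N. a j * X (n - int j) \<omega>)" for \<omega>
    proof -
      have "Z \<omega> = (\<Sum>j\<in>J. a j * X (n - int j) \<omega>)"
        unfolding Z_def by (subst sum.reindex) (auto simp: inj_on_def)
      also have "\<dots> = (\<Sum>j<N. a j * X (n - int j) \<omega>)"
        by (intro sum.mono_neutral_left) (auto simp: J_def)
      finally show ?thesis .
    qed
    have "AE \<omega> in M. linear_filter a n \<omega> - Z \<omega> = linear_filter b n \<omega>"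
      using AE_linear_filter_sums[OF a, of n]
    proof eventually_elim
      case (elim \<omega>)
      have "(\<lambda>j. if j \<in> {..<N} then a j * X (n - int j) \<omega> else 0) sums Z \<omega>"
        unfolding Z_eq by (rule sums_If_finite_set) simp
      then have "(\<lambda>j. a j * X (n - int j) \<omega> - (if j \<in> {..<N} then a j * X (n - int j) \<omega> else 0)) sums
          (linear_filter a n \<omega> - Z \<omega>)"
        using elim by (intro sums_diff) auto
      moreover have "(\<lambda>j. a j * X (n - int j) \<omega> - (if j \<in> {..<N} then a j * X (n - int j) \<omega> else 0)) =
          (\<lambda>j. b j * X (n - int j) \<omega>)"
        by (auto simp: b_def)
      ultimately show ?case
        by (simp add: linear_filter_def sums_iff)
    qed
    then have "(\<integral>\<omega>. (linear_filter a n \<omega> - Z \<omega>)\<^sup>2 \<partial>M) = (\<integral>\<omega>. (linear_filter b n \<omega>)\<^sup>2 \<partial>M)"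
      unfolding Z_eq by (intro integral_cong_AE) auto
    also have "\<dots> \<le> (\<Sum>j. \<bar>b j\<bar>)\<^sup>2 * cov_seq M X 0"
      by (rule square_integrable_linear_filter(2)[OF b])
    also have "(\<Sum>j. \<bar>b j\<bar>) = tail N"
      unfolding tail_def using suminf_split_initial_segment[OF b, of N] by (simp add: b_def)
    finally have "(\<integral>\<omega>. (linear_filter a n \<omega> - Z \<omega>)\<^sup>2 \<partial>M) < e"
      using N by simp
    then show ?thesis
      using Z_span by blast
  qed
  then show ?thesis
    using square_integrable_linear_filter(1)[OF a] by (simp add: closed_lin_span_def)
qed

lemma linear_filter_in_lin_span:
  assumes fin: "\<And>j. N \<le> j \<Longrightarrow> a j = 0" and I: "\<And>j. a j \<noteq> 0 \<Longrightarrow> n - int j \<in> I"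
  shows "linear_filter a n \<in> lin_span X I"
proof -
  define J where "J = {j. j < N \<and> a j \<noteq> 0}"
  have "linear_filter a n \<omega> = (\<Sum>k\<in>(\<lambda>j. n - int j) ` J. a (nat (n - k)) * X k \<omega>)" for \<omega>
  proof -
    have "linear_filter a n \<omega> = (\<Sum>j\<in>J. a j * X (n - int j) \<omega>)"
      unfolding linear_filter_def by (rule suminf_finite) (use fin in \<open>auto simp: J_def not_less\<close>)
    also have "\<dots> = (\<Sum>k\<in>(\<lambda>j. n - int j) ` J. a (nat (n - k)) * X k \<omega>)"
      by (subst sum.reindex) (auto simp: inj_on_def)
    finally show ?thesis .
  qed
  then show ?thesis
    unfolding lin_span_def using I
    by (auto simp: J_def fun_eq_iff intro!: exI[of _ "(\<lambda>j. n - int j) ` J"] exI[of _ "\<lambda>k. a (nat (n - k))"])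
qed

section \<open>Predictors as filters\<close>

lemma prediction_error_orthogonal:
  assumes w: "summable (\<lambda>j. \<bar>w j\<bar>)" and w0: "w 0 \<noteq> 0"
    and row: "(\<lambda>j. cov_seq M X (int i - int j) * w j) sums 0"
  shows "(\<integral>\<omega>. (X n \<omega> - linear_filter (prediction_filter w) n \<omega>) * X (n - int i) \<omega> \<partial>M) = 0"
proof -
  let ?b = "prediction_filter w"
  note b = prediction_filter_summable[OF w]
  have "(\<lambda>j. (if j = 0 then cov_seq M X (int i) else 0) - cov_seq M X (int i - int j) * w j / w 0) sums
      (cov_seq M X (int i) - 0 / w 0)"
    by (intro sums_diff sums_single sums_divide row)
  moreover have "(\<lambda>j. (if j = 0 then cov_seq M X (int i) else 0) - cov_seq M X (int i - int j) * w j / w 0) =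
      (\<lambda>j. ?b j * cov_seq M X (int i - int j))"
    using w0 by (auto simp: prediction_filter_def)
  ultimately have "(\<Sum>j. ?b j * cov_seq M X (int i - int j)) = cov_seq M X (int i)"
    by (simp add: sums_iff)
  moreover have "(\<integral>\<omega>. linear_filter ?b n \<omega> * X (n - int i) \<omega> \<partial>M) = (\<Sum>j. ?b j * cov_seq M X (int i - int j))"
    using linear_filter_inner_X[OF b, of n "n - int i"] by simp
  moreover have "(\<integral>\<omega>. X n \<omega> * X (n - int i) \<omega> \<partial>M) = cov_seq M X (int i)"
    using covariance[of n "n - int i"] by simp
  moreover have "integrable M (\<lambda>\<omega>. X n \<omega> * X (n - int i) \<omega>)"
    "integrable M (\<lambda>\<omega>. linear_filter ?b n \<omega> * X (n - int i) \<omega>)"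
    by (intro square_integrable_mult(1) square_integrable_X square_integrable_linear_filter(1) b)+
  ultimately show ?thesis
    by (simp add: left_diff_distrib)
qed

lemma predictor_AE_eq:
  assumes w: "summable (\<lambda>j. \<bar>w j\<bar>)" and w0: "w 0 \<noteq> 0"
    and rows: "\<And>i. 0 < i \<Longrightarrow> (\<lambda>j. cov_seq M X (int i - int j) * w j) sums 0"
  shows "predictor M X n \<in> square_integrable M"
    and "AE \<omega> in M. predictor M X n \<omega> = linear_filter (prediction_filter w) n \<omega>"
proof -
  let ?Z = "linear_filter (prediction_filter w) n"
  note b = prediction_filter_summable[OF w]
  have err: "(\<lambda>\<omega>. X n \<omega> - ?Z \<omega>) \<in> square_integrable M"
    by (intro square_integrable_diff square_integrable_X square_integrable_linear_filter(1) b)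
  have orth: "(\<integral>\<omega>. (X n \<omega> - ?Z \<omega>) * X k \<omega> \<partial>M) = 0" if "k \<in> {..n - 1}" for k
    using prediction_error_orthogonal[OF w w0 rows, of "nat (n - k)" n] that by simp
  have H: "past M X (n - 1) \<subseteq> square_integrable M"
    by (auto simp: past_def closed_lin_span_def)
  have Z: "?Z \<in> past M X (n - 1)"
    unfolding past_def
    by (rule linear_filter_in_closed_lin_span[OF b]) (simp add: prediction_filter_def split: if_splits)
  have perp: "(\<integral>\<omega>. (X n \<omega> - ?Z \<omega>) * W \<omega> \<partial>M) = 0" if "W \<in> past M X (n - 1)" for W
    using orthogonal_closed_lin_span[where X = X and I = "{..n - 1}", OF square_integrable_X err orth] that by (simp add: past_def)
  show "predictor M X n \<in> square_integrable M"
    "AE \<omega> in M. predictor M X n \<omega> = ?Z \<omega>"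
    unfolding predictor_def by (rule orth_proj_AE_eq[OF H square_integrable_X Z perp]; assumption)+
qed

lemma finite_predictor_AE_eq:
  assumes w: "\<And>j. p < j \<Longrightarrow> w j = 0" and w0: "w 0 \<noteq> 0"
    and rows: "\<And>i. 0 < i \<Longrightarrow> i \<le> p \<Longrightarrow> (\<Sum>j\<le>p. cov_seq M X (int i - int j) * w j) = 0"
  shows "finite_predictor M X p n \<in> square_integrable M"
    and "AE \<omega> in M. finite_predictor M X p n \<omega> = linear_filter (prediction_filter w) n \<omega>"
proof -
  let ?Z = "linear_filter (prediction_filter w) n" and ?I = "{n - 1 - int p + 1..n - 1}"
  have w_summable: "summable (\<lambda>j. \<bar>w j\<bar>)"
    by (rule summable_finite[of "{..p}"]) (auto simp: w)
  note b = prediction_filter_summable[OF w_summable]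
  have err: "(\<lambda>\<omega>. X n \<omega> - ?Z \<omega>) \<in> square_integrable M"
    by (intro square_integrable_diff square_integrable_X square_integrable_linear_filter(1) b)
  have row: "(\<lambda>j. cov_seq M X (int i - int j) * w j) sums 0" if "0 < i" "i \<le> p" for i
    using sums_finite[of "{..p}" "\<lambda>j. cov_seq M X (int i - int j) * w j"] rows[OF that] w by auto
  have orth: "(\<integral>\<omega>. (X n \<omega> - ?Z \<omega>) * X k \<omega> \<partial>M) = 0" if "k \<in> ?I" for k
    using prediction_error_orthogonal[OF w_summable w0 row, of "nat (n - k)" n] that
    by (simp add: nat_le_iff)
  have H: "finite_past X p (n - 1) \<subseteq> square_integrable M"
    unfolding finite_past_def by (rule square_integrable_lin_span) (rule square_integrable_X)
  have Z: "?Z \<in> finite_past X p (n - 1)"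
    unfolding finite_past_def
  proof (rule linear_filter_in_lin_span[of "Suc p"])
    show "prediction_filter w j = 0" if "Suc p \<le> j" for j
      using that w by (simp add: prediction_filter_def)
    then show "n - int j \<in> ?I" if "prediction_filter w j \<noteq> 0" for j
      using that by (cases "j = 0") (force simp: prediction_filter_def not_less_eq_eq)+
  qed
  have perp: "(\<integral>\<omega>. (X n \<omega> - ?Z \<omega>) * W \<omega> \<partial>M) = 0" if "W \<in> finite_past X p (n - 1)" for W
    using orthogonal_lin_span[where X = X and I = ?I, OF square_integrable_X err orth] that by (simp add: finite_past_def)
  show "finite_predictor M X p n \<in> square_integrable M"
    "AE \<omega> in M. finite_predictor M X p n \<omega> = ?Z \<omega>"
    unfolding finite_predictor_def by (rule orth_proj_AE_eq[OF H square_integrable_X Z perp]; assumption)+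
qed

end

lemma spectral_density_cosine_series:
  assumes R: "(\<lambda>k. \<bar>cov_seq M X k\<bar>) summable_on UNIV"
  shows "spectral_density M X l = (\<Sum>\<^sub>\<infinity>k. cov_seq M X k * cos (2 * pi * of_int k * l))"
proof -
  let ?f = "\<lambda>k. complex_of_real (cov_seq M X k) * exp (- 2 * of_real pi * \<i> * of_real l * of_int k)"
  have exp_eq: "exp (- 2 * of_real pi * \<i> * of_real l * of_int k) = cis (- (2 * pi * of_int k * l))" for k
    by (simp add: cis_conv_exp mult_ac)
  have "(\<lambda>k. norm (?f k)) summable_on UNIV"
    using R by (simp add: exp_eq norm_mult)
  then have "?f summable_on UNIV"
    by (rule abs_summable_summable)
  then have "spectral_density M X l = (\<Sum>\<^sub>\<infinity>k. Re (?f k))"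
    unfolding spectral_density_def by (rule infsum_Re[symmetric])
  also have "\<dots> = (\<Sum>\<^sub>\<infinity>k. cov_seq M X k * cos (2 * pi * of_int k * l))"
    unfolding exp_eq by simp
  finally show ?thesis .
qed

theorem proposition4p1:
  fixes M :: "'a measure" and X :: "int \<Rightarrow> 'a \<Rightarrow> real"
  assumes "prob_space M"
    and "zero_mean_wss M X"
    and "regular_process M X"
    and "\<And>n. (\<integral>\<omega>. (innovation M X n \<omega>)\<^sup>2 \<partial>M) = 1"
    and "\<And>l. l \<in> {- (1/2)<..1/2} \<Longrightarrow> spectral_density M X l > 0"
    and "(\<lambda>k. \<bar>cov_seq M X k\<bar>) summable_on UNIV"
  shows "(\<forall>p. zero_mean_wss M (finite_predictor M X p) \<and>
              (\<lambda>k. \<bar>cov_seq M (finite_predictor M X p) k\<bar>) summable_on UNIV)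
    \<and> zero_mean_wss M (predictor M X)
    \<and> (\<lambda>k. \<bar>cov_seq M (predictor M X) k\<bar>) summable_on UNIV
    \<and> (\<lambda>p. spectral_density M (finite_predictor M X p) 0)
        \<longlonglongrightarrow> spectral_density M (predictor M X) 0"
proof -
  interpret prob_space M
    by fact
  interpret wss_process M X
    by unfold_locales fact
  note R_summable = assms(6)
  obtain c where "positive_toeplitz (cov_seq M X) c"
  proof (rule positive_toeplitzI[OF R_summable])
    show "cov_seq M X (- k) = cov_seq M X k" for k
      by (rule cov_seq_uminus) fact
    show "(\<Sum>\<^sub>\<infinity>k. cov_seq M X k * cos (2 * pi * of_int k * l)) > 0" if "l \<in> {- (1/2)<..1/2}" for l
      using assms(5)[OF that] by (simp only: spectral_density_cosine_series[OF R_summable])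
  qed
  then interpret T: positive_toeplitz "cov_seq M X" c .
  let ?u = T.inverse_column and ?v = T.limit_column
  have u0: "0 < ?u p 0" for p
    using T.inverse_column_0_pos T.inverse_column_0_mono[of 0 p] by simp
  have u_summable: "summable (\<lambda>j. \<bar>?u p j\<bar>)" for p
    by (rule summable_finite[of "{..p}"]) (auto simp: T.inverse_column_eq_0)
  have u_suminf: "(\<Sum>j. ?u p j) = (\<Sum>j\<le>p. ?u p j)" for p
    by (rule suminf_finite) (auto simp: T.inverse_column_eq_0)
  note v0 = T.limit_column_0_pos and v_summable = T.limit_column_summable
  have u_row: "(\<Sum>j\<le>p. cov_seq M X (int i - int j) * ?u p j) = 0" if "0 < i" "i \<le> p" for p i
    using T.inverse_column_eq[OF that(2)] that(1) by simp
  have v_row: "(\<lambda>j. cov_seq M X (int i - int j) * ?v j) sums 0" if "0 < i" for i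
    using T.wiener_hopf[of i] that by simp
  note finite_AE = finite_predictor_AE_eq[OF T.inverse_column_eq_0 less_imp_neq[OF u0, symmetric] u_row]
    and infinite_AE = predictor_AE_eq[OF v_summable less_imp_neq[OF v0, symmetric] v_row]
  note u_filter = prediction_filter_summable[OF u_summable]
    and v_filter = prediction_filter_summable[OF v_summable]
  note finite_wss = wss_AE_cong[OF finite_AE linear_filter_wss[OF u_filter]]
    and infinite_wss = wss_AE_cong[OF infinite_AE linear_filter_wss[OF v_filter]]
  note finite_density = linear_filter_spectral_density_0[OF u_filter R_summable]
    and infinite_density = linear_filter_spectral_density_0[OF v_filter R_summable]
  have finite_value: "spectral_density M (finite_predictor M X p) 0 =
      (1 - (\<Sum>j\<le>p. ?u p j) / ?u p 0)\<^sup>2 * spectral_density M X 0" for p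
    using finite_density(2)[of p] u0[of p]
    by (simp add: spectral_density_def finite_wss(2) prediction_filter_suminf[OF u_summable] u_suminf)
  have infinite_value: "spectral_density M (predictor M X) 0 =
      (1 - (\<Sum>j. ?v j) / ?v 0)\<^sup>2 * spectral_density M X 0"
    using infinite_density(2) v0
    by (simp add: spectral_density_def infinite_wss(2) prediction_filter_suminf[OF v_summable])
  have "(\<lambda>p. spectral_density M (finite_predictor M X p) 0) \<longlonglongrightarrow> spectral_density M (predictor M X) 0"
    unfolding finite_value infinite_value
    by (intro tendsto_intros T.inverse_column_sum_LIMSEQ T.inverse_column_LIMSEQ) (use v0 in simp)
  then show ?thesis
    using finite_wss infinite_wss finite_density(1) infinite_density(1) by simp
qed

end
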